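(* Let $\mathfrak p=(\lambda,e_2)\in\mathcal S$, let $c=c(\lambda,e_2)>0$, and let $\mu_{\mathfrak p}$ be the solution described in the context. Define $$\Theta_{\mathfrak p}(s)=2\sqrt c\int_0^s\frac{\mu_{\mathfrak p}^2(\mu_{\mathfrak p}+2\lambda)}{1+4c\mu_{\mathfrak p}^2}\,ds .$$ Then $$\gamma_{\mathfrak p}=\frac1{2\sqrt c\,\mu_{\mathfrak p}}\left(\sqrt{1+4c\mu_{\mathfrak p}^2}\,\cosh(\Theta_{\mathfrak p}),\ \sqrt{1+4c\mu_{\mathfrak p}^2}\,\sinh(\Theta_{\mathfrak p}),\ 1\right)$$ is a BS-curve with modulus $\mathfrak p$ and momentum $\vec\xi=(0,0,-\sqrt c)$. Moreover, there are no BS-strings, i.e. no BS-curve is closed.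
   Context: **Hyperbolic plane and curves.** $\mathbb{R}^{1,2}$ is $\mathbb{R}^3$ with the inner product $\vec x\cdot\vec y=-x^1y^1+x^2y^2+x^3y^3$ and the cross product defined by $(\vec x\times\vec y)\cdot\vec w=\det(\vec x,\vec y,\vec w)$. The hyperbolic plane is $\mathcal{H}^2=\{\vec x\in\mathbb{R}^{1,2}: \vec x\cdot\vec x=-1,\ x^1>0\}$ with the induced metric. For a curve $\gamma$ in $\mathcal{H}^2$ (smooth, immersed, on its maximal interval of definition) with arc length $s$, a dot denotes $d/ds$ and the geodesic curvature $\kappa$ is defined by $\ddot\gamma=\gamma+\kappa\,\gamma\times\dot\gamma$. A curve is convex if $\kappa$ never vanishes, and it is then oriented so that $\kappa>0$; its Blaschke invariant is $\mu=\sqrt\kappa$. A curve is closed if it is periodic. **B-curves.** Let $Q_{\lambda,c}(x)=x^4+4\lambda x^3+4(\lambda^2-c)x^2-1$. A B-curve is a convex curve whose Blaschke invariant $\mu$ is a non-constant periodic solution of $\dot\mu^2=-\mu^2Q_{\lambda,c}(\mu)$ for some $\lambda,c\in\mathbb{R}$; then $Q_{\lambda,c}$ has four distinct real roots $e_1>e_2>e_3>0>e_4$, and the pair $(\lambda,e_2)$ is called the modulus of the curve. The momentum of a B-curve is the constant vector $\vec\xi=\frac1{2\mu}\gamma+\frac{\dot\mu}{2\mu^2}\dot\gamma-(\lambda+\frac\mu2)\gamma\times\dot\gamma$, which satisfies $\vec\xi\cdot\vec\xi=c$. A BS-curve is a B-curve with space-like momentum (so $c>0$); a BS-string is a closed BS-curve.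 **Moduli.** $\mathfrak{P}=\{(\lambda,e_2)\in\mathbb{R}^2: e_2>0,\ e_2^4+2\lambda e_2^3+1<0\}$. For $(\lambda,e_2)\in\mathfrak P$ let $c(\lambda,e_2)$ be the unique $c$ with $Q_{\lambda,c}(e_2)=0$, namely $c=\lambda^2+\lambda e_2+\frac{e_2^2}{4}-\frac1{4e_2^2}$ (then $e_2$ is the second largest of the four distinct real roots $e_1>e_2>e_3>0>e_4$ of $Q_{\lambda,c}$). Set $\mathcal S=\{(\lambda,e_2)\in\mathfrak P: c(\lambda,e_2)>0\}$. For $\mathfrak p=(\lambda,e_2)\in\mathfrak P$, $\mu_{\mathfrak p}$ is the solution of $\ddot\mu=\frac{2\dot\mu^2}{\mu}-\mu-2\lambda\mu^4-\mu^5$ with $\mu(0)=e_2$, $\dot\mu(0)=0$; it is positive, non-constant, periodic and satisfies $\dot\mu_{\mathfrak p}^2=-\mu_{\mathfrak p}^2Q_{\lambda,c}(\mu_{\mathfrak p})$. *)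

theory Defs
  imports "HOL-Analysis.Analysis"
begin

section \<open>Minkowski 3-space and the hyperbolic plane\<close>

definition lorentz :: "real^3 \<Rightarrow> real^3 \<Rightarrow> real"  (infixl "\<bullet>\<^sub>L" 70) where
  "x \<bullet>\<^sub>L y = - (x$1 * y$1) + x$2 * y$2 + x$3 * y$3"

definition lcross :: "real^3 \<Rightarrow> real^3 \<Rightarrow> real^3"  (infixr "\<times>\<^sub>L" 80) where
  "x \<times>\<^sub>L y = (THE z. \<forall>w. z \<bullet>\<^sub>L w = det (vector [x, y, w] :: real^3^3))"

lemma lcross_unique:
  assumes "\<And>w. z \<bullet>\<^sub>L w = det (vector [x, y, w] :: real^3^3)"
  shows "z = vector [x$3 * y$2 - x$2 * y$3, x$3 * y$1 - x$1 * y$3, x$1 * y$2 - x$2 * y$1]"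
  using assms[of "axis 1 1"] assms[of "axis 2 1"] assms[of "axis 3 1"]
  by (simp add: vec_eq_iff forall_3 lorentz_def det_3 axis_def)

lemma lcross_eq:
  "x \<times>\<^sub>L y = vector [x$3 * y$2 - x$2 * y$3, x$3 * y$1 - x$1 * y$3, x$1 * y$2 - x$2 * y$1]"
  unfolding lcross_def
proof (rule the_equality)
  show "\<forall>w. vector [x$3 * y$2 - x$2 * y$3, x$3 * y$1 - x$1 * y$3, x$1 * y$2 - x$2 * y$1] \<bullet>\<^sub>L w
      = det (vector [x, y, w] :: real^3^3)"
    by (simp add: lorentz_def det_3 algebra_simps)
qed (use lcross_unique in blast)

lemma lcross_lorentz: "(x \<times>\<^sub>L y) \<bullet>\<^sub>L w = det (vector [x, y, w] :: real^3^3)"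
  by (simp add: lcross_eq lorentz_def det_3 algebra_simps)

definition hyp_plane :: "(real^3) set" where
  "hyp_plane = {x. x \<bullet>\<^sub>L x = -1 \<and> x$1 > 0}"

section \<open>Curves\<close>

definition dot :: "(real \<Rightarrow> 'a::real_normed_vector) \<Rightarrow> real \<Rightarrow> 'a" where
  "dot f s = vector_derivative f (at s)"

definition smooth_curve_on :: "real set \<Rightarrow> (real \<Rightarrow> 'a::real_normed_vector) \<Rightarrow> bool" where
  "smooth_curve_on I f \<longleftrightarrow> (\<forall>k. \<forall>s\<in>I. ((dot ^^ k) f) differentiable (at s))"

(* Immersed curves are given by their arc-length parametrization s |-> \<gamma> s, so that dot is the
   derivative with respect to arc length.  Values of \<gamma> outside the interval I are irrelevant. *)
definition hyp_arc :: "real set \<Rightarrow> (real \<Rightarrow> real^3) \<Rightarrow> bool" where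
  "hyp_arc I \<gamma> \<longleftrightarrow> open I \<and> is_interval I \<and> I \<noteq> {} \<and> \<gamma> ` I \<subseteq> hyp_plane \<and>
     smooth_curve_on I \<gamma> \<and> (\<forall>s\<in>I. dot \<gamma> s \<bullet>\<^sub>L dot \<gamma> s = 1)"

(* The second conjunct says that I is the maximal interval of definition. *)
definition hyp_curve :: "real set \<Rightarrow> (real \<Rightarrow> real^3) \<Rightarrow> bool" where
  "hyp_curve I \<gamma> \<longleftrightarrow> hyp_arc I \<gamma> \<and>
     (\<forall>J \<beta>. hyp_arc J \<beta> \<and> I \<subseteq> J \<and> (\<forall>s\<in>I. \<beta> s = \<gamma> s) \<longrightarrow> J = I)"

definition geodesic_curvature :: "(real \<Rightarrow> real^3) \<Rightarrow> real \<Rightarrow> real" where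
  "geodesic_curvature \<gamma> s =
     (THE k. dot (dot \<gamma>) s = \<gamma> s + k *\<^sub>R (\<gamma> s \<times>\<^sub>L dot \<gamma> s))"

(* A nowhere vanishing curvature has constant sign; a convex curve is by convention traversed in
   the direction that makes this sign positive. *)
definition convex_curve :: "real set \<Rightarrow> (real \<Rightarrow> real^3) \<Rightarrow> bool" where
  "convex_curve I \<gamma> \<longleftrightarrow> hyp_curve I \<gamma> \<and> (\<forall>s\<in>I. geodesic_curvature \<gamma> s > 0)"

definition blaschke :: "(real \<Rightarrow> real^3) \<Rightarrow> real \<Rightarrow> real" where
  "blaschke \<gamma> s = sqrt (geodesic_curvature \<gamma> s)"

(* Forces I = UNIV as soon as I is a nonempty interval. *)
definition periodic_on :: "real set \<Rightarrow> (real \<Rightarrow> 'a) \<Rightarrow> bool" where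
  "periodic_on I f \<longleftrightarrow> (\<exists>T>0. \<forall>s\<in>I. s + T \<in> I \<and> s - T \<in> I \<and> f (s + T) = f s)"

definition closed_curve :: "real set \<Rightarrow> (real \<Rightarrow> real^3) \<Rightarrow> bool" where
  "closed_curve I \<gamma> \<longleftrightarrow> hyp_curve I \<gamma> \<and> periodic_on I \<gamma>"

section \<open>B-curves\<close>

definition Q :: "real \<Rightarrow> real \<Rightarrow> real \<Rightarrow> real" where
  "Q lam c x = x^4 + 4 * lam * x^3 + 4 * (lam\<^sup>2 - c) * x\<^sup>2 - 1"

definition B_curve_with :: "real \<Rightarrow> real \<Rightarrow> real set \<Rightarrow> (real \<Rightarrow> real^3) \<Rightarrow> bool" where
  "B_curve_with lam c I \<gamma> \<longleftrightarrow> convex_curve I \<gamma> \<and>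
     (\<forall>s\<in>I. (dot (blaschke \<gamma>) s)\<^sup>2 = - (blaschke \<gamma> s)\<^sup>2 * Q lam c (blaschke \<gamma> s)) \<and>
     periodic_on I (blaschke \<gamma>) \<and> \<not> (blaschke \<gamma>) constant_on I"

definition B_curve :: "real set \<Rightarrow> (real \<Rightarrow> real^3) \<Rightarrow> bool" where
  "B_curve I \<gamma> \<longleftrightarrow> (\<exists>lam c. B_curve_with lam c I \<gamma>)"

definition has_modulus :: "real set \<Rightarrow> (real \<Rightarrow> real^3) \<Rightarrow> real \<times> real \<Rightarrow> bool" where
  "has_modulus I \<gamma> p \<longleftrightarrow> (case p of (lam, e2) \<Rightarrow>
     \<exists>c. B_curve_with lam c I \<gamma> \<and>
       (\<exists>e1 e3 e4. e1 > e2 \<and> e2 > e3 \<and> e3 > 0 \<and> 0 > e4 \<and> {x. Q lam c x = 0} = {e1, e2, e3, e4}))"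

definition momentum_at :: "real \<Rightarrow> (real \<Rightarrow> real^3) \<Rightarrow> real \<Rightarrow> real^3" where
  "momentum_at lam \<gamma> s = (let \<mu> = blaschke \<gamma> s; \<mu>' = dot (blaschke \<gamma>) s in
     (1 / (2 * \<mu>)) *\<^sub>R \<gamma> s + (\<mu>' / (2 * \<mu>\<^sup>2)) *\<^sub>R dot \<gamma> s
       - (lam + \<mu> / 2) *\<^sub>R (\<gamma> s \<times>\<^sub>L dot \<gamma> s))"

(* The pair (lam, c) is determined by \<gamma>: the values of a non-constant Blaschke invariant fill an
   interval, on which Q lam c is prescribed.  Hence at most one \<xi> satisfies this. *)
definition has_momentum :: "real set \<Rightarrow> (real \<Rightarrow> real^3) \<Rightarrow> real^3 \<Rightarrow> bool" where
  "has_momentum I \<gamma> \<xi> \<longleftrightarrow>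
     (\<exists>lam c. B_curve_with lam c I \<gamma> \<and> (\<forall>s\<in>I. momentum_at lam \<gamma> s = \<xi>))"

definition BS_curve :: "real set \<Rightarrow> (real \<Rightarrow> real^3) \<Rightarrow> bool" where
  "BS_curve I \<gamma> \<longleftrightarrow> B_curve I \<gamma> \<and> (\<exists>\<xi>. has_momentum I \<gamma> \<xi> \<and> \<xi> \<bullet>\<^sub>L \<xi> > 0)"

definition BS_string :: "real set \<Rightarrow> (real \<Rightarrow> real^3) \<Rightarrow> bool" where
  "BS_string I \<gamma> \<longleftrightarrow> BS_curve I \<gamma> \<and> closed_curve I \<gamma>"

section \<open>Moduli\<close>

definition moduli_P :: "(real \<times> real) set" where
  "moduli_P = {(lam, e2). e2 > 0 \<and> e2^4 + 2 * lam * e2^3 + 1 < 0}"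

definition c_mod :: "real \<Rightarrow> real \<Rightarrow> real" where
  "c_mod lam e2 = lam\<^sup>2 + lam * e2 + e2\<^sup>2 / 4 - 1 / (4 * e2\<^sup>2)"

lemma Q_eq_0_iff_c_mod:
  assumes "e2 > 0"
  shows "Q lam c e2 = 0 \<longleftrightarrow> c = c_mod lam e2"
proof -
  have "Q lam c e2 = 4 * e2\<^sup>2 * (c_mod lam e2 - c)"
    using assms by (simp add: Q_def c_mod_def field_simps power4_eq_xxxx power3_eq_cube power2_eq_square)
  thus ?thesis using assms by auto
qed

definition moduli_S :: "(real \<times> real) set" where
  "moduli_S = {(lam, e2) \<in> moduli_P. c_mod lam e2 > 0}"

(* The equation is singular at \<mu> = 0, so positivity only says that \<mu> stays in its domain. *)
definition is_mu_solution :: "real \<Rightarrow> real \<Rightarrow> (real \<Rightarrow> real) \<Rightarrow> bool" where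
  "is_mu_solution lam e2 \<mu> \<longleftrightarrow> \<mu> 0 = e2 \<and> dot \<mu> 0 = 0 \<and>
     (\<forall>s. \<mu> s > 0 \<and> (\<mu> has_real_derivative dot \<mu> s) (at s) \<and>
       (dot \<mu> has_real_derivative
          (2 * (dot \<mu> s)\<^sup>2 / \<mu> s - \<mu> s - 2 * lam * (\<mu> s)^4 - (\<mu> s)^5)) (at s))"

definition Theta :: "real \<Rightarrow> real \<Rightarrow> (real \<Rightarrow> real) \<Rightarrow> real \<Rightarrow> real" where
  "Theta lam c \<mu> s =
     2 * sqrt c * (LBINT t=0..s. (\<mu> t)\<^sup>2 * (\<mu> t + 2 * lam) / (1 + 4 * c * (\<mu> t)\<^sup>2))"

definition gamma_mod :: "real \<Rightarrow> real \<Rightarrow> (real \<Rightarrow> real) \<Rightarrow> real \<Rightarrow> real^3" where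
  "gamma_mod lam c \<mu> s = (1 / (2 * sqrt c * \<mu> s)) *\<^sub>R
     vector [sqrt (1 + 4 * c * (\<mu> s)\<^sup>2) * cosh (Theta lam c \<mu> s),
             sqrt (1 + 4 * c * (\<mu> s)\<^sup>2) * sinh (Theta lam c \<mu> s),
             1]"

end

theory Submission
  imports Defs
begin

text \<open>
  Along a B-curve with momentum \<open>\<xi>\<close>, differentiating \<open>\<gamma> \<bullet>\<^sub>L \<xi> = - 1 / (2 * \<mu>)\<close> twice gives the second-order
  equation for \<open>\<mu>\<close>. Put \<open>A = 1 / (2 * \<mu>)\<close>, \<open>B = \<mu>' / (2 * \<mu>\<^sup>2)\<close>, \<open>C = lam + \<mu> / 2\<close>, so that
  \<open>\<xi> = A \<gamma> + B \<gamma>' - C (\<gamma> \<times>\<^sub>L \<gamma>')\<close> and \<open>B\<^sup>2 + C\<^sup>2 = c + A\<^sup>2 = \<rho>\<^sup>2\<close>. The pair \<open>(C / \<rho>, B / \<rho>)\<close> moves on the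
  unit circle with an angular velocity \<open>w\<close> that is a function of \<open>\<mu>\<close> alone and is positive along
  the orbit; this makes \<open>\<mu>\<close> periodic.

  The Lorentz plane orthogonal to \<open>\<xi>\<close> contains null vectors \<open>l\<close> with \<open>\<xi> \<times>\<^sub>L l = sqrt c *\<^sub>R l\<close>, and
  \<open>\<phi> = \<gamma> \<bullet>\<^sub>L l\<close> satisfies \<open>(\<phi> / \<rho>)' = \<Theta>' (\<phi> / \<rho>)\<close> with \<open>\<Theta>' = sqrt c * C / \<rho>\<^sup>2\<close>, which changes sign. Since
  \<open>(B / \<rho>)' = - w C / \<rho>\<close>, integration by parts gives \<open>\<Theta>' = sqrt c * (- (h B / \<rho>)' + h' B / \<rho>)\<close> with
  \<open>h = 1 / (\<rho> w)\<close>. As \<open>h\<close> is a decreasing function of \<open>\<mu>\<close> and \<open>B\<close> has the sign of \<open>\<mu>'\<close>, the last term is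
  nonpositive and not identically zero: \<open>\<Theta>\<close> strictly decreases over a period, so the curve never
  closes.
\<close>

section \<open>Periodic real functions\<close>

text \<open>\<open>f'\<close> turns negative just to the right of \<open>s\<close>, so
  \<open>f\<close> drops there; this excludes a minimum at \<open>s\<close>.\<close>

lemma deriv_zero_second_deriv_neg:
  fixes f f' :: "real \<Rightarrow> real"
  assumes d: "\<And>t. (f has_real_derivative f' t) (at t)"
    and "f' s = 0" and d2: "(f' has_real_derivative m) (at s)" and m: "m < 0"
  obtains t where "f t < f s"
proof -
  obtain e where e: "e > 0" "\<And>x. 0 < x \<Longrightarrow> x < e \<Longrightarrow> f' (s + x) < f' s"
    using DERIV_neg_dec_right[OF d2 m] by blast
  have "f (s + e / 2) < f s"
  proof (rule DERIV_neg_imp_decreasing_open[where f = f])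
    show "s < s + e / 2" using e by simp
    show "\<exists>y. (f has_real_derivative y) (at x) \<and> y < 0" if "s < x" "x < s + e / 2" for x
      using e(2)[of "x - s"] that \<open>f' s = 0\<close> d[of x] e(1) by (auto intro!: exI[of _ "f' x"])
    show "continuous_on {s..s + e / 2} f"
      using d by (meson DERIV_continuous continuous_at_imp_continuous_on)
  qed
  then show ?thesis using that by blast
qed

lemma periodic_nat:
  fixes f :: "real \<Rightarrow> 'a"
  assumes "\<And>s. f (s + T) = f s"
  shows "f (s + real n * T) = f s"
proof (induction n)
  case (Suc n)
  have "f (s + real (Suc n) * T) = f ((s + real n * T) + T)" by (simp add: algebra_simps)
  then show ?case using assms Suc by simp
qed simp

lemma periodic_reach:
  fixes f :: "real \<Rightarrow> 'a"
  assumes "\<And>s. f (s + T) = f s" "T > 0"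
  obtains t where "t \<ge> a" "f t = f s"
proof -
  obtain n where "(a - s) / T \<le> real n" using real_arch_simple by blast
  then have "a \<le> s + real n * T" using \<open>T > 0\<close> by (simp add: field_simps)
  then show ?thesis using that[of "s + real n * T"] periodic_nat[of f T, OF assms(1)] by simp
qed

text \<open>Each value recurs arbitrarily late, where an antitone function can no longer exceed
  \<open>f y\<close>.\<close>

lemma periodic_mono_const:
  fixes f :: "real \<Rightarrow> real"
  assumes per: "\<And>s. f (s + T) = f s" and "T > 0" and anti: "\<And>x y. x \<le> y \<Longrightarrow> f y \<le> f x"
  shows "f x = f y"
proof -
  have le: "f x \<le> f y" for x y
  proof -
    obtain t where "t \<ge> y" "f t = f x" using periodic_reach[of f T y x] per \<open>T > 0\<close> by metis
    then show ?thesis using anti[of y t] by simp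
  qed
  then show ?thesis by (simp add: antisym)
qed

lemma periodic_attains_inf:
  fixes f :: "real \<Rightarrow> real"
  assumes per: "\<And>s. f (s + T) = f s" and T: "T > 0" and "continuous_on UNIV f"
  obtains a where "\<And>s. f a \<le> f s"
proof -
  have "continuous_on {0..T} f" using assms(3) continuous_on_subset by blast
  then obtain a where a: "a \<in> {0..T}" "\<And>t. t \<in> {0..T} \<Longrightarrow> f a \<le> f t"
    using continuous_attains_inf[of "{0..T}" f] T by auto
  have "f a \<le> f s" for s
  proof -
    define n where "n = \<lfloor>s / T\<rfloor>"
    have "of_int n \<le> s / T" "s / T < of_int n + 1" unfolding n_def by linarith+
    then have "s - of_int n * T \<in> {0..T}" using T by (simp add: field_simps)
    moreover have "f (s - of_int n * T) = f s"
    \<comment> \<open>\<open>periodic_nat\<close> only shifts forward: for negative \<open>n\<close>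
      it starts at \<open>s\<close>, otherwise at the reduced point.\<close>
    proof (cases "n \<ge> 0")
      case True
      then show ?thesis using periodic_nat[of f T "s - of_int n * T" "nat n", OF per] by simp
    next
      case False
      then show ?thesis using periodic_nat[of f T s "nat (-n)", OF per] by simp
    qed
    ultimately show ?thesis using a(2) by metis
  qed
  then show ?thesis using that by blast
qed

lemma shift_deriv_unique:
  assumes "\<And>s. f (s + T) = f s" "\<And>s. (f has_real_derivative f' s) (at s)"
  shows "f' (s + T) = f' s"
proof -
  have "((\<lambda>s. f (s + T)) has_real_derivative f' (s + T)) (at s)"
    using assms(2)[of "s + T"] by (simp add: DERIV_shift)
  then have "(f has_real_derivative f' (s + T)) (at s)" using assms(1) by simp
  then show ?thesis using assms(2) DERIV_unique by blast
qed

lemma LBINT_deriv: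
  fixes f :: "real \<Rightarrow> real"
  assumes "continuous_on UNIV f"
  shows "((\<lambda>s. LBINT t=0..s. f t) has_real_derivative f s) (at s)"
proof -
  \<comment> \<open>Both \<open>0\<close> and \<open>s\<close> are interior, so the derivative
    within this interval is two-sided.\<close>
  let ?a = "- \<bar>s\<bar> - 1" and ?b = "\<bar>s\<bar> + 1"
  have "((\<lambda>u. LBINT y=ereal 0..u. f y) has_vector_derivative f s) (at s within {?a..?b})"
    using assms by (intro interval_integral_FTC2) (auto intro: continuous_on_subset)
  then show ?thesis
    by (simp add: at_within_Icc_at has_real_derivative_iff_has_vector_derivative zero_ereal_def)
qed

section \<open>The equation for the Blaschke invariant\<close>

text \<open>The second-order equation governs the motion through zeros of \<open>\<mu>'\<close>; the
  first-order one fixes the constant of integration \<open>c\<close>.\<close>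

locale blaschke_flow =
  fixes lam c :: real and \<mu> \<mu>' :: "real \<Rightarrow> real"
  assumes c_pos: "c > 0"
    and mu_pos: "\<mu> s > 0"
    and mu_deriv: "(\<mu> has_real_derivative \<mu>' s) (at s)"
    and mu'_deriv: "(\<mu>' has_real_derivative
          (2 * (\<mu>' s)\<^sup>2 / \<mu> s - \<mu> s - 2 * lam * (\<mu> s)^4 - (\<mu> s)^5)) (at s)"
    and first_integral: "(\<mu>' s)\<^sup>2 = - (\<mu> s)\<^sup>2 * Q lam c (\<mu> s)"
begin

section \<open>Coordinates of the momentum in the moving frame, and their rotation\<close>

definition A where "A s = 1 / (2 * \<mu> s)"
definition B where "B s = \<mu>' s / (2 * (\<mu> s)\<^sup>2)"
definition C where "C s = lam + \<mu> s / 2"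
definition \<rho> where "\<rho> s = sqrt (c + (A s)\<^sup>2)"

text \<open>Up to a positive factor, \<open>g\<close> is the derivative of \<open>C / \<rho>\<close>
  viewed as a function of \<open>\<mu>\<close>, and it carries the sign of the angular velocity
  \<open>w\<close>. Where \<open>g\<close> is nonzero, \<open>h (\<mu> s)\<close> is
  \<open>1 / (\<rho> s * w s)\<close>.\<close>

definition g where "g x = 4 * c * x^3 + 2 * x + 2 * lam"
definition w where "w s = \<mu> s * g (\<mu> s) / (1 + 4 * c * (\<mu> s)\<^sup>2)"
definition h where "h x = 2 * sqrt (1 + 4 * c * x\<^sup>2) / g x"

lemma mu_nz: "\<mu> s \<noteq> 0"
  using mu_pos[of s] by simp

lemma g_mono: "x \<le> y \<Longrightarrow> 0 \<le> x \<Longrightarrow> g x \<le> g y"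
  unfolding g_def using c_pos by (intro add_mono mult_left_mono power_mono) auto

text \<open>\<open>- A\<close>, \<open>B\<close>, \<open>- C\<close> are the products of a constant
  vector with position, velocity and normal, so these three derivatives are Frenet equations with
  curvature \<open>\<mu>\<^sup>2\<close>.\<close>

lemma A_deriv: "(A has_real_derivative - B s) (at s)"
  unfolding A_def[abs_def] B_def
  using mu_nz by (auto intro!: derivative_eq_intros mu_deriv simp: field_simps power2_eq_square)

lemma B_deriv: "(B has_real_derivative - A s - (\<mu> s)\<^sup>2 * C s) (at s)"
proof -
  have "((\<lambda>s. \<mu>' s / (2 * (\<mu> s)\<^sup>2)) has_real_derivative
     ((2 * (\<mu>' s)\<^sup>2 / \<mu> s - \<mu> s - 2 * lam * (\<mu> s)^4 - (\<mu> s)^5) * (2 * (\<mu> s)\<^sup>2)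
       - \<mu>' s * (2 * (2 * \<mu> s * \<mu>' s))) / (2 * (\<mu> s)\<^sup>2 * (2 * (\<mu> s)\<^sup>2))) (at s)"
    using mu_nz by (auto intro!: derivative_eq_intros mu_deriv mu'_deriv)
  moreover have "((2 * (\<mu>' s)\<^sup>2 / \<mu> s - \<mu> s - 2 * lam * (\<mu> s)^4 - (\<mu> s)^5) * (2 * (\<mu> s)\<^sup>2)
       - \<mu>' s * (2 * (2 * \<mu> s * \<mu>' s))) / (2 * (\<mu> s)\<^sup>2 * (2 * (\<mu> s)\<^sup>2)) = - A s - (\<mu> s)\<^sup>2 * C s"
    using mu_nz[of s] by (simp add: A_def C_def field_simps) algebra
  ultimately show ?thesis unfolding B_def[abs_def] by simp
qed

lemma C_deriv: "(C has_real_derivative (\<mu> s)\<^sup>2 * B s) (at s)"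
  unfolding C_def[abs_def] B_def
  using mu_nz by (auto intro!: derivative_eq_intros mu_deriv)

lemma rho_sq: "(\<rho> s)\<^sup>2 = c + (A s)\<^sup>2"
  unfolding \<rho>_def using c_pos by (simp add: add_nonneg_nonneg)

lemma rho_pos: "\<rho> s > 0"
  unfolding \<rho>_def using c_pos by (simp add: add_pos_nonneg)

text \<open>The first integral divided by \<open>4 * \<mu>^4\<close>; geometrically, the momentum
  has squared norm \<open>c\<close>.\<close>

lemma BC_rho: "(B s)\<^sup>2 + (C s)\<^sup>2 = (\<rho> s)\<^sup>2"
proof -
  have "(B s)\<^sup>2 = - Q lam c (\<mu> s) / (4 * (\<mu> s)\<^sup>2)"
    using first_integral[of s] mu_nz[of s] by (simp add: B_def power_divide field_simps)
  then show ?thesis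
    unfolding rho_sq using mu_nz[of s]
    by (simp add: A_def C_def Q_def field_simps) algebra
qed

lemma sqrt_mu: "sqrt (1 + 4 * c * (\<mu> s)\<^sup>2) = 2 * \<mu> s * \<rho> s"
proof (rule real_sqrt_unique)
  show "(2 * \<mu> s * \<rho> s)\<^sup>2 = 1 + 4 * c * (\<mu> s)\<^sup>2"
    using mu_nz[of s] by (simp add: power_mult_distrib rho_sq A_def power_divide field_simps)
  show "0 \<le> 2 * \<mu> s * \<rho> s" using mu_pos rho_pos by (simp add: less_imp_le)
qed

lemma one_plus_pos: "1 + 4 * c * x\<^sup>2 > 0"
  using c_pos by (simp add: add_pos_nonneg)

lemma one_plus_mu: "1 + 4 * c * (\<mu> s)\<^sup>2 = 4 * (\<mu> s)\<^sup>2 * (\<rho> s)\<^sup>2"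
  using mu_nz[of s] by (simp add: rho_sq A_def power_divide field_simps)

lemma rho_deriv: "(\<rho> has_real_derivative - A s * B s / \<rho> s) (at s)"
proof -
  have "c + (A s)\<^sup>2 > 0" using c_pos by (simp add: add_pos_nonneg)
  then show ?thesis unfolding \<rho>_def[abs_def]
    by (auto intro!: derivative_eq_intros A_deriv simp: field_simps)
qed

lemma w_eq: "w s = (\<mu> s)\<^sup>2 + A s * C s / (\<rho> s)\<^sup>2"
proof -
  have "g (\<mu> s) = 4 * \<mu> s * ((\<mu> s)\<^sup>2 * (\<rho> s)\<^sup>2 + A s * C s)"
    using mu_nz[of s] by (simp add: g_def rho_sq A_def C_def power_divide field_simps) algebra
  then show ?thesis
    unfolding w_def one_plus_mu using mu_nz[of s] rho_pos[of s]
    by (simp add: field_simps power4_eq_xxxx power2_eq_square)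
qed

lemma u_deriv: "((\<lambda>s. C s / \<rho> s) has_real_derivative B s / \<rho> s * w s) (at s)"
  using rho_pos[of s]
  by (auto intro!: derivative_eq_intros C_deriv rho_deriv simp: w_eq field_simps power2_eq_square)

lemma v_deriv: "((\<lambda>s. B s / \<rho> s) has_real_derivative - (C s / \<rho> s) * w s) (at s)"
proof -
  have "((\<lambda>s. B s / \<rho> s) has_real_derivative
      ((- A s - (\<mu> s)\<^sup>2 * C s) * \<rho> s - B s * (- A s * B s / \<rho> s)) / (\<rho> s * \<rho> s)) (at s)"
    using rho_pos[of s] by (auto intro!: derivative_eq_intros B_deriv rho_deriv)
  moreover have "((- A s - (\<mu> s)\<^sup>2 * C s) * \<rho> s - B s * (- A s * B s / \<rho> s)) / (\<rho> s * \<rho> s)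
      = - (C s / \<rho> s) * w s"
  proof -
    \<comment> \<open>Here, unlike for \<open>C / \<rho>\<close>, the quotient rule leaves a term in
      \<open>B\<^sup>2\<close>, which the circle relation removes.\<close>
    have b: "(B s)\<^sup>2 = (\<rho> s)\<^sup>2 - (C s)\<^sup>2" using BC_rho[of s] by simp
    have "\<rho> s \<noteq> 0" using rho_pos[of s] by simp
    then show ?thesis unfolding w_eq using b by (simp add: field_simps) algebra
  qed
  ultimately show ?thesis by simp
qed

section \<open>Turning points, equilibria and the sign of the angular velocity\<close>

lemma mu_continuous: "continuous_on UNIV \<mu>"
  using mu_deriv by (meson DERIV_continuous continuous_at_imp_continuous_on)

text \<open>The factor \<open>1 + 2 * lam * \<mu>^3 + \<mu>^4\<close> is \<open>\<mu> / 2\<close>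
  times the derivative of \<open>Q\<close> at this root. Its sign separates minima from maxima, and
  the factorization of \<open>g\<close> transfers that information to \<open>w\<close>.\<close>

lemma turning_point:
  assumes "\<mu>' s = 0"
  shows "Q lam c (\<mu> s) = 0"
    and "g (\<mu> s) = (\<mu> s + 2 * lam) * (1 + 2 * lam * (\<mu> s)^3 + (\<mu> s)^4)"
    and "(\<mu>' has_real_derivative - \<mu> s * (1 + 2 * lam * (\<mu> s)^3 + (\<mu> s)^4)) (at s)"
proof -
  show Q0: "Q lam c (\<mu> s) = 0" using first_integral[of s] assms mu_nz[of s] by simp
  then have "\<mu> s * g (\<mu> s) = \<mu> s * ((\<mu> s + 2 * lam) * (1 + 2 * lam * (\<mu> s)^3 + (\<mu> s)^4))"
    unfolding g_def Q_def by algebra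
  then show "g (\<mu> s) = (\<mu> s + 2 * lam) * (1 + 2 * lam * (\<mu> s)^3 + (\<mu> s)^4)"
    using mu_nz[of s] by simp
  have "2 * (\<mu>' s)\<^sup>2 / \<mu> s - \<mu> s - 2 * lam * (\<mu> s)^4 - (\<mu> s)^5
      = - \<mu> s * (1 + 2 * lam * (\<mu> s)^3 + (\<mu> s)^4)" using assms by (simp add: algebra_simps eval_nat_numeral)
  then show "(\<mu>' has_real_derivative - \<mu> s * (1 + 2 * lam * (\<mu> s)^3 + (\<mu> s)^4)) (at s)"
    using mu'_deriv[of s] by simp
qed

text \<open>Given the root, the last assumption says that the derivative of \<open>Q\<close>
  vanishes at \<open>a\<close> too. The cofactor of \<open>(x - a)\<^sup>2\<close> is then forced by
  the leading, cubic and constant coefficients.\<close>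

lemma Q_double_root:
  assumes "a > 0" "Q lam c a = 0" "1 + 2 * lam * a^3 + a^4 = 0"
  shows "Q lam c x = - (x - a)\<^sup>2 * (1 / a\<^sup>2 - x\<^sup>2 - (4 * lam + 2 * a) * x)"
proof -
  have "a\<^sup>2 * Q lam c x = - (x - a)\<^sup>2 * (1 - a\<^sup>2 * x\<^sup>2 - (4 * lam + 2 * a) * a\<^sup>2 * x)"
    using assms(2,3) unfolding Q_def by algebra
  then show ?thesis using assms(1) by (simp add: field_simps)
qed

text \<open>At an equilibrium value \<open>a\<close> the right-hand side of the first integral vanishes to second
  order, so \<open>\<mu> - a\<close> satisfies a linear differential inequality.\<close>

lemma equilibrium_const:
  assumes per: "\<And>s. \<mu> (s + T) = \<mu> s" "T > 0"
    and zero: "\<mu>' a = 0" "1 + 2 * lam * (\<mu> a)^3 + (\<mu> a)^4 = 0"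
  shows "\<mu> s = \<mu> a"
proof -
  obtain b where b: "\<And>s. \<mu> s \<le> \<mu> b"
  proof -
    obtain b where "\<And>s. - \<mu> b \<le> - \<mu> s"
      using periodic_attains_inf[of "\<lambda>s. - \<mu> s" T] per continuous_on_minus[OF mu_continuous] by metis
    then show ?thesis by (intro that[of b]) simp
  qed
  \<comment> \<open>A Lipschitz constant: the maximum \<open>\<mu> b\<close> bounds
    \<open>\<mu>\<close>, and the second factor bounds the square root of the cofactor from
    \<open>Q_double_root\<close>.\<close>
  define K where "K = \<mu> b * (1 / \<mu> a + sqrt \<bar>4 * lam + 2 * \<mu> a\<bar> * sqrt (\<mu> b))"
  define y where "y s = (\<mu> s - \<mu> a)" for s
  have bound: "\<bar>\<mu>' s\<bar> \<le> K * \<bar>y s\<bar>" for s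
  proof -
    let ?m = "\<bar>4 * lam + 2 * \<mu> a\<bar>"
    have K2: "(1 / \<mu> a)\<^sup>2 + ?m * \<mu> b \<le> (1 / \<mu> a + sqrt ?m * sqrt (\<mu> b))\<^sup>2"
      using mu_pos[of a] mu_pos[of b] by (simp add: power2_sum power_mult_distrib)
    have "(\<mu>' s)\<^sup>2 = (\<mu> s)\<^sup>2 * (y s)\<^sup>2 * (1 / (\<mu> a)\<^sup>2 - (\<mu> s)\<^sup>2 - (4 * lam + 2 * \<mu> a) * \<mu> s)"
      unfolding first_integral[of s] Q_double_root[OF mu_pos turning_point(1)[OF zero(1)] zero(2)] y_def
      by simp
    also have "\<dots> \<le> (\<mu> b)\<^sup>2 * (y s)\<^sup>2 * (1 / \<mu> a + sqrt ?m * sqrt (\<mu> b))\<^sup>2"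
    proof (rule order_trans[OF mult_left_mono mult_right_mono])
      have "- ((4 * lam + 2 * \<mu> a) * \<mu> s) \<le> ?m * \<mu> b"
        using mu_pos[of s] b[of s]
        by (smt (verit) abs_ge_minus_self mult_mono mult_minus_left)
      then show "1 / (\<mu> a)\<^sup>2 - (\<mu> s)\<^sup>2 - (4 * lam + 2 * \<mu> a) * \<mu> s \<le> (1 / \<mu> a + sqrt ?m * sqrt (\<mu> b))\<^sup>2"
        using K2 zero_le_power2[of "\<mu> s"] unfolding power_one_over by linarith
      show "(\<mu> s)\<^sup>2 * (y s)\<^sup>2 \<le> (\<mu> b)\<^sup>2 * (y s)\<^sup>2"
        using b[of s] mu_pos[of s] by (intro mult_right_mono power_mono) auto
    qed auto
    finally have "\<bar>\<mu>' s\<bar>\<^sup>2 \<le> (K * \<bar>y s\<bar>)\<^sup>2" unfolding K_def by (simp add: power_mult_distrib mult_ac)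
    moreover have "0 \<le> K * \<bar>y s\<bar>" unfolding K_def using mu_pos by (simp add: less_imp_le add_nonneg_nonneg)
    ultimately show ?thesis by (rule power2_le_imp_le)
  qed
  \<comment> \<open>Gronwall weight: the bound on \<open>\<mu>'\<close> makes \<open>F\<close>
    nonincreasing, and \<open>F a = 0\<close>.\<close>
  define F where "F s = (y s)\<^sup>2 * exp (- 2 * K * s)" for s
  have F_deriv: "(F has_real_derivative 2 * exp (- 2 * K * s) * (y s * \<mu>' s - K * (y s)\<^sup>2)) (at s)" for s
    unfolding F_def[abs_def] y_def
    by (auto intro!: derivative_eq_intros mu_deriv simp: algebra_simps power2_eq_square)
  have F_nonpos: "2 * exp (- 2 * K * s) * (y s * \<mu>' s - K * (y s)\<^sup>2) \<le> 0" for s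
  proof -
    have "y s * \<mu>' s \<le> \<bar>y s\<bar> * \<bar>\<mu>' s\<bar>" by (metis abs_ge_self abs_mult)
    also have "\<dots> \<le> \<bar>y s\<bar> * (K * \<bar>y s\<bar>)" using bound by (intro mult_left_mono) auto
    also have "\<dots> = K * (y s)\<^sup>2" by (simp add: power2_eq_square)
    finally show ?thesis by (simp add: mult_nonneg_nonpos)
  qed
  \<comment> \<open>The estimate only runs forward from \<open>a\<close>; periodicity replaces
    \<open>s\<close> by a later time with the same value.\<close>
  obtain t where t: "t \<ge> a" "\<mu> t = \<mu> s" using periodic_reach[of \<mu> T a s] per by metis
  have "F t \<le> F a" using F_deriv F_nonpos by (intro DERIV_nonpos_imp_nonincreasing[OF t(1)]) blast
  then have "(y t)\<^sup>2 * exp (- 2 * K * t) \<le> 0" by (simp add: F_def y_def)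
  then have "y t = 0" by (simp add: mult_le_0_iff)
  then show ?thesis using t by (simp add: y_def)
qed

text \<open>At a minimum of \<open>\<mu>\<close> the second derivative test and
  \<open>equilibrium_const\<close> make the factor \<open>?k\<close> negative. This forces
  \<open>\<mu> a + 2 * lam < 0\<close>, so \<open>g (\<mu> a)\<close> is a product of two negative
  numbers, and \<open>g\<close> is monotone.\<close>

lemma periodic_g_pos:
  assumes per: "\<And>s. \<mu> (s + T) = \<mu> s" "T > 0" and nonconst: "\<mu> s0 \<noteq> \<mu> s1"
  shows "lam < 0" and "g (\<mu> s) > 0"
proof -
  obtain a where a: "\<And>s. \<mu> a \<le> \<mu> s"
    using periodic_attains_inf[of \<mu> T] per mu_continuous by metis
  have z: "\<mu>' a = 0" using DERIV_local_min[OF mu_deriv, of 1 a] a by simp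
  let ?k = "1 + 2 * lam * (\<mu> a)^3 + (\<mu> a)^4"
  have "?k \<noteq> 0" using equilibrium_const[of T a] per z nonconst by metis
  moreover have "\<not> ?k > 0"
  proof
    assume "?k > 0"
    then obtain t where "\<mu> t < \<mu> a"
      using deriv_zero_second_deriv_neg[of \<mu> \<mu>' a, OF mu_deriv z turning_point(3)[OF z]] mu_pos[of a]
      by (auto simp: zero_less_mult_iff)
    then show False using a[of t] by simp
  qed
  ultimately have k: "?k < 0" by simp
  then have "(\<mu> a)^3 * (\<mu> a + 2 * lam) < 0" by (simp add: algebra_simps eval_nat_numeral)
  then have al: "\<mu> a + 2 * lam < 0" using mu_pos[of a] by (simp add: mult_less_0_iff)
  then show "lam < 0" using mu_pos[of a] by simp
  have "g (\<mu> a) > 0" unfolding turning_point(2)[OF z] using k al by (simp add: mult_neg_neg)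
  also have "g (\<mu> a) \<le> g (\<mu> s)"
    using g_mono[OF a] mu_pos[of a] by simp
  finally show "g (\<mu> s) > 0" .
qed

text \<open>Once the root is cleared, no term of the numerator is positive when
  \<open>lam < 0\<close>, and the constant is \<open>-2\<close>.\<close>

lemma h_deriv:
  assumes "g x > 0" "lam < 0" "x > 0"
  obtains d where "d < 0" "(h has_real_derivative d) (at x)"
proof -
  let ?r = "sqrt (1 + 4 * c * x\<^sup>2)"
  have r: "?r > 0" "?r\<^sup>2 = 1 + 4 * c * x\<^sup>2" using one_plus_pos[of x] by auto
  have "(g has_real_derivative 12 * c * x\<^sup>2 + 2) (at x)"
    unfolding g_def[abs_def] by (auto intro!: derivative_eq_intros)
  then have "(h has_real_derivative
      (8 * c * x / ?r * g x - 2 * ?r * (12 * c * x\<^sup>2 + 2)) / (g x)\<^sup>2) (at x)"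
    unfolding h_def[abs_def] using assms(1) one_plus_pos[of x]
    by (auto intro!: derivative_eq_intros simp: power2_eq_square field_simps)
  moreover have "(8 * c * x / ?r * g x - 2 * ?r * (12 * c * x\<^sup>2 + 2)) / (g x)\<^sup>2
      = 2 * (- (32 * c\<^sup>2 * x^4) - 12 * c * x\<^sup>2 + 8 * c * lam * x - 2) / (?r * (g x)\<^sup>2)"
  proof -
    have "8 * c * x * g x - 2 * ?r\<^sup>2 * (12 * c * x\<^sup>2 + 2)
      = 2 * (- (32 * c\<^sup>2 * x^4) - 12 * c * x\<^sup>2 + 8 * c * lam * x - 2)"
      unfolding r g_def by (simp add: algebra_simps eval_nat_numeral)
    then have "8 * c * x / ?r * g x - 2 * ?r * (12 * c * x\<^sup>2 + 2)
      = 2 * (- (32 * c\<^sup>2 * x^4) - 12 * c * x\<^sup>2 + 8 * c * lam * x - 2) / ?r"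
      using r(1) by (simp add: field_simps power2_eq_square)
    then show ?thesis by simp
  qed
  moreover have "2 * (- (32 * c\<^sup>2 * x^4) - 12 * c * x\<^sup>2 + 8 * c * lam * x - 2) / (?r * (g x)\<^sup>2) < 0"
  proof (rule divide_neg_pos)
    have "8 * c * lam * x < 0" using c_pos assms by (simp add: mult_less_0_iff zero_less_mult_iff)
    moreover have "32 * c\<^sup>2 * x^4 \<ge> 0" "12 * c * x\<^sup>2 \<ge> 0" using c_pos by auto
    ultimately have "- (32 * c\<^sup>2 * x^4) - 12 * c * x\<^sup>2 + 8 * c * lam * x - 2 < 0" by linarith
    then show "2 * (- (32 * c\<^sup>2 * x^4) - 12 * c * x\<^sup>2 + 8 * c * lam * x - 2) < 0"
      by (rule mult_pos_neg[rotated]) simp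
    show "0 < ?r * (g x)\<^sup>2" using r assms by simp
  qed
  ultimately show ?thesis using that by metis
qed

text \<open>The factor \<open>exp (sqrt c * h (\<mu> s) * (B s / \<rho> s))\<close> turns the oscillating logarithmic
  derivative \<open>sqrt c * C s / (\<rho> s)\<^sup>2\<close> of \<open>\<phi> / \<rho>\<close> into one of constant sign, because \<open>h\<close> decreases.\<close>

lemma no_periodic_solution:
  assumes per: "\<And>s. \<mu> (s + T) = \<mu> s" "T > 0" and nonconst: "\<mu> s0 \<noteq> \<mu> s1"
    and phi: "\<And>s. (\<phi> has_real_derivative (sqrt c * C s - A s * B s) / (\<rho> s)\<^sup>2 * \<phi> s) (at s)"
    and phi_per: "\<And>s. \<phi> (s + T) = \<phi> s"
    and s: "\<mu>' s \<noteq> 0"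
  shows "\<phi> s = 0"
proof -
  note gp = periodic_g_pos[of T, OF per nonconst]
  have "\<exists>d. d < 0 \<and> (h has_real_derivative d) (at (\<mu> s))" for s
    using h_deriv[OF gp(2) gp(1) mu_pos, of s] by blast
  then obtain h' where h': "\<And>s. h' s < 0" "\<And>s. (h has_real_derivative h' s) (at (\<mu> s))"
    by metis
  \<comment> \<open>The logarithmic derivative left for \<open>\<psi>\<close> below. Since
    \<open>B\<close> contains one factor \<open>\<mu>'\<close>, \<open>k\<close> is a negative
    multiple of \<open>(\<mu>')\<^sup>2\<close>.\<close>
  define k where "k s = sqrt c * (h' s * \<mu>' s * (B s / \<rho> s))" for s
  have k_eq: "k s = sqrt c * h' s * ((\<mu>' s)\<^sup>2 / (2 * (\<mu> s)\<^sup>2 * \<rho> s))" for s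
    by (simp add: k_def B_def power2_eq_square)
  have k: "k s \<le> 0" for s
  proof -
    have "sqrt c * h' s \<le> 0" using h'(1)[of s] c_pos by (simp add: mult_le_0_iff less_imp_le)
    moreover have "(\<mu>' s)\<^sup>2 / (2 * (\<mu> s)\<^sup>2 * \<rho> s) \<ge> 0" using rho_pos[of s] by simp
    ultimately show ?thesis unfolding k_eq by (rule mult_nonpos_nonneg)
  qed
  have ks: "k s < 0"
  proof -
    have "(\<mu>' s)\<^sup>2 / (2 * (\<mu> s)\<^sup>2 * \<rho> s) > 0" using s mu_nz rho_pos by simp
    moreover have "sqrt c * h' s < 0" using h'(1)[of s] c_pos by (simp add: mult_less_0_iff)
    ultimately show ?thesis unfolding k_eq by (rule mult_neg_pos[rotated])
  qed
  \<comment> \<open>Thanks to this identity, the derivative of \<open>B / \<rho>\<close> inside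
    \<open>E\<close> cancels the sign-changing term
    \<open>sqrt c * C s / (\<rho> s)\<^sup>2\<close>.\<close>
  have hw: "h (\<mu> s) * w s = 1 / \<rho> s" for s
  proof -
    have "h (\<mu> s) * w s = 2 * (2 * \<mu> s * \<rho> s) * \<mu> s / (4 * (\<mu> s)\<^sup>2 * (\<rho> s)\<^sup>2)"
      unfolding h_def w_def sqrt_mu using gp(2)[of s] by (simp add: one_plus_mu)
    also have "\<dots> = 1 / \<rho> s" using mu_nz[of s] rho_pos[of s] by (simp add: field_simps power2_eq_square)
    finally show ?thesis .
  qed
  define E where "E s = exp (sqrt c * (h (\<mu> s) * (B s / \<rho> s)))" for s
  define \<psi> where "\<psi> s = \<phi> s / \<rho> s * E s" for s
  have E_deriv: "(E has_real_derivative E s * (k s - sqrt c * C s / (\<rho> s)\<^sup>2)) (at s)" for s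
  proof -
    have "((\<lambda>s. h (\<mu> s)) has_real_derivative h' s * \<mu>' s) (at s)"
      using DERIV_chain2[OF h'(2) mu_deriv] .
    then have d: "(E has_real_derivative E s * (sqrt c * (h' s * \<mu>' s * (B s / \<rho> s)
        + - (C s / \<rho> s) * w s * h (\<mu> s)))) (at s)"
      unfolding E_def[abs_def] by (intro DERIV_fun_exp DERIV_cmult DERIV_mult v_deriv)
    have "- (C s / \<rho> s) * w s * h (\<mu> s) = - C s / (\<rho> s)\<^sup>2"
      using hw[of s] by (simp add: mult.assoc mult.commute[of "w s"] power2_eq_square)
    then show ?thesis by (intro DERIV_cong[OF d]) (simp add: k_def algebra_simps)
  qed
  have psi_deriv: "(\<psi> has_real_derivative k s * \<psi> s) (at s)" for s
  proof -
    have r: "\<rho> s \<noteq> 0" using rho_pos[of s] by simp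
    have "((\<lambda>s. \<phi> s / \<rho> s) has_real_derivative
       ((sqrt c * C s - A s * B s) / (\<rho> s)\<^sup>2 * \<phi> s * \<rho> s - \<phi> s * (- A s * B s / \<rho> s)) / (\<rho> s * \<rho> s)) (at s)"
      using r by (auto intro!: derivative_eq_intros phi rho_deriv)
    moreover have "((sqrt c * C s - A s * B s) / (\<rho> s)\<^sup>2 * \<phi> s * \<rho> s - \<phi> s * (- A s * B s / \<rho> s)) / (\<rho> s * \<rho> s)
      = sqrt c * C s / (\<rho> s)\<^sup>2 * (\<phi> s / \<rho> s)"
      using r by (simp add: field_simps power2_eq_square)
    ultimately have "((\<lambda>s. \<phi> s / \<rho> s) has_real_derivative sqrt c * C s / (\<rho> s)\<^sup>2 * (\<phi> s / \<rho> s)) (at s)"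
      by simp
    from DERIV_mult[OF this E_deriv[of s]]
    show ?thesis unfolding \<psi>_def[abs_def] by (simp add: algebra_simps)
  qed
  \<comment> \<open>The square is nonincreasing whatever the sign of \<open>\<psi>\<close>.\<close>
  define F where "F s = (\<psi> s)\<^sup>2" for s
  have F_deriv: "(F has_real_derivative 2 * (k s * F s)) (at s)" for s
    unfolding F_def[abs_def] by (auto intro!: derivative_eq_intros psi_deriv simp: power2_eq_square)
  have mu'_per: "\<mu>' (s + T) = \<mu>' s" for s
    using shift_deriv_unique[of \<mu> T \<mu>'] per mu_deriv by blast
  have "F (s + T) = F s" for s
    using per(1)[of s] mu'_per[of s] phi_per[of s] by (simp add: F_def \<psi>_def E_def B_def \<rho>_def A_def)
  moreover have "F y \<le> F x" if "x \<le> y" for x y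
  proof (rule DERIV_nonpos_imp_nonincreasing[OF that])
    show "\<exists>d. (F has_real_derivative d) (at s) \<and> d \<le> 0" for s
      using F_deriv[of s] k[of s] by (intro exI[of _ "2 * (k s * F s)"]) (simp add: F_def mult_nonpos_nonneg)
  qed
  \<comment> \<open>Periodic and monotone, \<open>F\<close> is constant; its zero derivative
    \<open>2 * (k s * F s)\<close> with \<open>k s < 0\<close> then forces
    \<open>F s = 0\<close>.\<close>
  ultimately have "F x = F s" for x using periodic_mono_const[of F T] per(2) by blast
  then have "F = (\<lambda>_. F s)" by blast
  then have "(F has_real_derivative 0) (at s)" by (metis DERIV_const)
  then have "2 * (k s * F s) = 0" using F_deriv DERIV_unique by blast
  then have "\<psi> s = 0" using ks by (simp add: F_def)
  then show ?thesis using rho_pos[of s] by (simp add: \<psi>_def E_def)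
qed

end

section \<open>Closed curves with constant space-like momentum\<close>

lemma lcross_nth:
  "(x \<times>\<^sub>L y) $ 1 = x$3 * y$2 - x$2 * y$3"
  "(x \<times>\<^sub>L y) $ 2 = x$3 * y$1 - x$1 * y$3"
  "(x \<times>\<^sub>L y) $ 3 = x$1 * y$2 - x$2 * y$1"
  by (simp_all add: lcross_eq)

lemma lorentz_simps:
  "(x + y) \<bullet>\<^sub>L z = x \<bullet>\<^sub>L z + y \<bullet>\<^sub>L z" "(x - y) \<bullet>\<^sub>L z = x \<bullet>\<^sub>L z - y \<bullet>\<^sub>L z"
  "(a *\<^sub>R x) \<bullet>\<^sub>L z = a * (x \<bullet>\<^sub>L z)" "(- x) \<bullet>\<^sub>L z = - (x \<bullet>\<^sub>L z)"
  "z \<bullet>\<^sub>L (x + y) = z \<bullet>\<^sub>L x + z \<bullet>\<^sub>L y" "z \<bullet>\<^sub>L (x - y) = z \<bullet>\<^sub>L x - z \<bullet>\<^sub>L y"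
  "z \<bullet>\<^sub>L (a *\<^sub>R x) = a * (z \<bullet>\<^sub>L x)" "z \<bullet>\<^sub>L (- x) = - (z \<bullet>\<^sub>L x)"
  by (simp_all add: lorentz_def algebra_simps)

lemma lorentz_commute: "x \<bullet>\<^sub>L y = y \<bullet>\<^sub>L x"
  by (simp add: lorentz_def)

lemma lcross_orth: "x \<bullet>\<^sub>L (x \<times>\<^sub>L y) = 0" "y \<bullet>\<^sub>L (x \<times>\<^sub>L y) = 0"
  "(x \<times>\<^sub>L y) \<bullet>\<^sub>L x = 0" "(x \<times>\<^sub>L y) \<bullet>\<^sub>L y = 0"
  by (simp_all add: lorentz_def lcross_nth algebra_simps)

lemma lcross_linear:
  "x \<times>\<^sub>L (y + z) = x \<times>\<^sub>L y + x \<times>\<^sub>L z" "x \<times>\<^sub>L (y - z) = x \<times>\<^sub>L y - x \<times>\<^sub>L z"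
  "x \<times>\<^sub>L (a *\<^sub>R y) = a *\<^sub>R (x \<times>\<^sub>L y)" "x \<times>\<^sub>L x = 0"
  by (simp_all add: vec_eq_iff forall_3 lcross_nth algebra_simps)

text \<open>The signature reverses the Euclidean sign, here and in
  \<open>lcross_norm\<close>.\<close>

lemma lcross_triple:
  "x \<times>\<^sub>L (y \<times>\<^sub>L z) = (x \<bullet>\<^sub>L y) *\<^sub>R z - (x \<bullet>\<^sub>L z) *\<^sub>R y"
  by (simp add: vec_eq_iff forall_3 lcross_nth lorentz_def algebra_simps)

lemma lcross_norm: "(x \<times>\<^sub>L y) \<bullet>\<^sub>L (x \<times>\<^sub>L y) = (x \<bullet>\<^sub>L y)\<^sup>2 - (x \<bullet>\<^sub>L x) * (y \<bullet>\<^sub>L y)"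
  by (simp add: lcross_nth lorentz_def algebra_simps power2_eq_square)

lemma lcross_rotate: "(x \<times>\<^sub>L y) \<bullet>\<^sub>L z = (z \<times>\<^sub>L x) \<bullet>\<^sub>L y"
  by (simp add: lcross_nth lorentz_def algebra_simps)

text \<open>The triple product formula gives \<open>v \<times>\<^sub>L n = 0\<close>; applied again
  to \<open>n \<times>\<^sub>L (v \<times>\<^sub>L n)\<close> it recovers \<open>v\<close>.\<close>

lemma orthogonal_complement_frame:
  assumes n: "n = x \<times>\<^sub>L y" "n \<bullet>\<^sub>L n = 1" and v: "v \<bullet>\<^sub>L x = 0" "v \<bullet>\<^sub>L y = 0"
  shows "v = (v \<bullet>\<^sub>L n) *\<^sub>R n"
proof -
  have "n \<times>\<^sub>L (v \<times>\<^sub>L n) = 0"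
    unfolding n(1) lcross_triple[of v] v by (simp add: vec_eq_iff forall_3 lcross_nth)
  then have "(v \<bullet>\<^sub>L n) *\<^sub>R n = v" unfolding lcross_triple by (simp add: n(2) lorentz_commute)
  then show ?thesis by simp
qed

lemma geodesic_curvature_eqI:
  assumes eq: "dot (dot \<gamma>) s = \<gamma> s + k *\<^sub>R (\<gamma> s \<times>\<^sub>L dot \<gamma> s)" and nz: "\<gamma> s \<times>\<^sub>L dot \<gamma> s \<noteq> 0"
  shows "geodesic_curvature \<gamma> s = k"
  unfolding geodesic_curvature_def using assms by (intro the_equality) auto

lemma lorentz_has_deriv:
  assumes "(f has_vector_derivative f') (at s)" "(g has_vector_derivative g') (at s)"
  shows "((\<lambda>s. f s \<bullet>\<^sub>L g s) has_real_derivative (f' \<bullet>\<^sub>L g s + f s \<bullet>\<^sub>L g')) (at s)"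
proof -
  have f: "((\<lambda>s. f s $ i) has_real_derivative f' $ i) (at s)"
   and g: "((\<lambda>s. g s $ i) has_real_derivative g' $ i) (at s)" for i
    using bounded_linear.has_vector_derivative[OF bounded_linear_vec_nth assms(1)]
      bounded_linear.has_vector_derivative[OF bounded_linear_vec_nth assms(2)]
    by (auto simp: has_real_derivative_iff_has_vector_derivative)
  show ?thesis unfolding lorentz_def
    by (auto intro!: derivative_eq_intros f g simp: algebra_simps)
qed

lemma smooth_has_deriv:
  assumes "smooth_curve_on UNIV \<gamma>"
  shows "(((dot ^^ k) \<gamma>) has_vector_derivative (dot ^^ Suc k) \<gamma> s) (at s)"
  using assms unfolding smooth_curve_on_def
  by (auto simp: dot_def[abs_def] vector_derivative_works)

text \<open>Translates of one point in both directions are unbounded, and an interval contains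
  everything between them.\<close>

lemma periodic_on_UNIV:
  assumes "is_interval I" "I \<noteq> {}" "periodic_on I f"
  shows "I = UNIV"
proof -
  obtain T where T: "T > 0" "\<And>s. s \<in> I \<Longrightarrow> s + T \<in> I \<and> s - T \<in> I"
    using assms(3) unfolding periodic_on_def by blast
  obtain s0 where s0: "s0 \<in> I" using assms(2) by blast
  have n: "s0 + real n * T \<in> I \<and> s0 - real n * T \<in> I" for n
  proof (induction n)
    case (Suc n)
    then show ?case using T(2)[of "s0 + real n * T"] T(2)[of "s0 - real n * T"] by (simp add: algebra_simps)
  qed (simp add: s0)
  have "x \<in> I" for x
  proof -
    obtain n where "\<bar>x - s0\<bar> / T \<le> real n" using real_arch_simple by blast
    then have "\<bar>x - s0\<bar> \<le> real n * T" using T(1) by (simp add: field_simps)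
    then have "s0 - real n * T \<le> x" "x \<le> s0 + real n * T" by linarith+
    then show ?thesis using n[of n] assms(1) unfolding is_interval_1 by blast
  qed
  then show ?thesis by auto
qed

section \<open>Frenet equations for curves defined on the whole line\<close>

locale hyp_line =
  fixes \<gamma> :: "real \<Rightarrow> real^3"
  assumes on_plane: "\<gamma> s \<bullet>\<^sub>L \<gamma> s = -1"
    and smooth: "smooth_curve_on UNIV \<gamma>"
    and unit_speed: "dot \<gamma> s \<bullet>\<^sub>L dot \<gamma> s = 1"
begin

definition n where "n s = \<gamma> s \<times>\<^sub>L dot \<gamma> s"

lemma gamma_deriv: "(\<gamma> has_vector_derivative dot \<gamma> s) (at s)"
  using smooth_has_deriv[OF smooth, of 0 s] by simp

lemma dot_gamma_deriv: "(dot \<gamma> has_vector_derivative dot (dot \<gamma>) s) (at s)"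
  using smooth_has_deriv[OF smooth, of 1 s] by simp

lemma velocity_orth: "\<gamma> s \<bullet>\<^sub>L dot \<gamma> s = 0"
proof -
  have "((\<lambda>s. \<gamma> s \<bullet>\<^sub>L \<gamma> s) has_real_derivative (dot \<gamma> s \<bullet>\<^sub>L \<gamma> s + \<gamma> s \<bullet>\<^sub>L dot \<gamma> s)) (at s)"
    by (rule lorentz_has_deriv gamma_deriv)+
  then have "((\<lambda>s. -1) has_real_derivative (2 * (\<gamma> s \<bullet>\<^sub>L dot \<gamma> s))) (at s)"
    by (simp add: on_plane lorentz_commute[of "dot \<gamma> s"])
  then show ?thesis using DERIV_unique[OF _ DERIV_const] by fastforce
qed

lemma accel_velocity: "dot \<gamma> s \<bullet>\<^sub>L dot (dot \<gamma>) s = 0"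
proof -
  have "((\<lambda>s. dot \<gamma> s \<bullet>\<^sub>L dot \<gamma> s) has_real_derivative
      (dot (dot \<gamma>) s \<bullet>\<^sub>L dot \<gamma> s + dot \<gamma> s \<bullet>\<^sub>L dot (dot \<gamma>) s)) (at s)"
    by (rule lorentz_has_deriv dot_gamma_deriv)+
  then have "((\<lambda>s. 1) has_real_derivative (2 * (dot \<gamma> s \<bullet>\<^sub>L dot (dot \<gamma>) s))) (at s)"
    by (simp add: unit_speed lorentz_commute[of "dot (dot \<gamma>) s"])
  then show ?thesis using DERIV_unique[OF _ DERIV_const] by fastforce
qed

lemma accel_position: "\<gamma> s \<bullet>\<^sub>L dot (dot \<gamma>) s = -1"
proof -
  have "((\<lambda>s. \<gamma> s \<bullet>\<^sub>L dot \<gamma> s) has_real_derivative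
      (dot \<gamma> s \<bullet>\<^sub>L dot \<gamma> s + \<gamma> s \<bullet>\<^sub>L dot (dot \<gamma>) s)) (at s)"
    by (rule lorentz_has_deriv gamma_deriv dot_gamma_deriv)+
  then have "((\<lambda>s. 0) has_real_derivative (1 + \<gamma> s \<bullet>\<^sub>L dot (dot \<gamma>) s)) (at s)"
    by (simp add: unit_speed velocity_orth)
  then show ?thesis using DERIV_unique[OF _ DERIV_const] by fastforce
qed

lemma n_unit: "n s \<bullet>\<^sub>L n s = 1"
  by (simp add: n_def lcross_norm velocity_orth on_plane unit_speed)

lemma n_orth: "\<gamma> s \<bullet>\<^sub>L n s = 0" "dot \<gamma> s \<bullet>\<^sub>L n s = 0"
  by (simp_all add: n_def lcross_orth)

text \<open>Acceleration minus position is orthogonal to position and velocity, hence a multiple of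
  the normal; as the normal is nonzero, the coefficient is unique.\<close>

lemma frenet: "dot (dot \<gamma>) s = \<gamma> s + geodesic_curvature \<gamma> s *\<^sub>R n s"
proof -
  have "dot (dot \<gamma>) s - \<gamma> s = ((dot (dot \<gamma>) s - \<gamma> s) \<bullet>\<^sub>L n s) *\<^sub>R n s"
    by (rule orthogonal_complement_frame[OF n_def n_unit])
      (simp_all add: lorentz_simps on_plane lorentz_commute[of "dot (dot \<gamma>) s"] accel_position
        accel_velocity velocity_orth)
  then obtain k where k: "dot (dot \<gamma>) s = \<gamma> s + k *\<^sub>R (\<gamma> s \<times>\<^sub>L dot \<gamma> s)"
    unfolding n_def by (metis add.commute diff_add_cancel)
  moreover have "\<gamma> s \<times>\<^sub>L dot \<gamma> s \<noteq> 0"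
    using n_unit[of s] by (auto simp: n_def lorentz_def)
  ultimately show ?thesis using geodesic_curvature_eqI by (metis n_def)
qed

end

text \<open>Pairing the constant \<open>\<xi>\<close> with the Frenet frame expresses
  \<open>\<mu>\<close> and its derivative through differentiable functions, from which the
  second-order equation follows.\<close>

lemma momentum_blaschke_flow:
  assumes "hyp_line \<gamma>" and pos: "\<And>s. geodesic_curvature \<gamma> s > 0"
    and ode: "\<And>s. (dot (blaschke \<gamma>) s)\<^sup>2 = - (blaschke \<gamma> s)\<^sup>2 * Q lam c (blaschke \<gamma> s)"
    and mom: "\<And>s. momentum_at lam \<gamma> s = \<xi>" and "\<xi> \<bullet>\<^sub>L \<xi> > 0"
  shows "blaschke_flow lam c (blaschke \<gamma>) (dot (blaschke \<gamma>))"
    and "\<xi> \<bullet>\<^sub>L \<xi> = c"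
    and "\<gamma> s \<bullet>\<^sub>L \<xi> = - blaschke_flow.A (blaschke \<gamma>) s"
    and "\<xi> = blaschke_flow.A (blaschke \<gamma>) s *\<^sub>R \<gamma> s
      + blaschke_flow.B (blaschke \<gamma>) (dot (blaschke \<gamma>)) s *\<^sub>R dot \<gamma> s
      - blaschke_flow.C lam (blaschke \<gamma>) s *\<^sub>R (\<gamma> s \<times>\<^sub>L dot \<gamma> s)"
proof -
  interpret hyp_line \<gamma> by fact
  let ?\<mu> = "blaschke \<gamma>" and ?d = "dot (blaschke \<gamma>)"
  have mu: "?\<mu> s > 0" "(?\<mu> s)\<^sup>2 = geodesic_curvature \<gamma> s" for s
    using pos[of s] by (simp_all add: blaschke_def)
  have xi: "\<xi> = (1 / (2 * ?\<mu> s)) *\<^sub>R \<gamma> s + (?d s / (2 * (?\<mu> s)\<^sup>2)) *\<^sub>R dot \<gamma> s - (lam + ?\<mu> s / 2) *\<^sub>R n s" for s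
    using mom[of s] by (simp add: momentum_at_def Let_def n_def)
  have g_xi: "\<gamma> s \<bullet>\<^sub>L \<xi> = - (1 / (2 * ?\<mu> s))" for s
    by (subst xi[of s]) (simp add: lorentz_simps on_plane velocity_orth n_orth)
  have t_xi: "dot \<gamma> s \<bullet>\<^sub>L \<xi> = ?d s / (2 * (?\<mu> s)\<^sup>2)" for s
    by (subst xi[of s]) (simp add: lorentz_simps lorentz_commute[of "dot \<gamma> s" "\<gamma> s"] unit_speed velocity_orth n_orth)
  have n_xi: "n s \<bullet>\<^sub>L \<xi> = - (lam + ?\<mu> s / 2)" for s
    by (subst xi[of s]) (simp add: lorentz_simps lorentz_commute[of "n s"] n_unit n_orth)
  have const: "((\<lambda>_. \<xi>) has_vector_derivative 0) (at s)" for s by (rule has_vector_derivative_const)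
  have d1: "((\<lambda>s. \<gamma> s \<bullet>\<^sub>L \<xi>) has_real_derivative ?d s / (2 * (?\<mu> s)\<^sup>2)) (at s)" for s
    using lorentz_has_deriv[OF gamma_deriv const, of s] by (simp add: t_xi lorentz_def[of _ 0])
  have d2: "((\<lambda>s. dot \<gamma> s \<bullet>\<^sub>L \<xi>) has_real_derivative
      - (1 / (2 * ?\<mu> s)) - (?\<mu> s)\<^sup>2 * (lam + ?\<mu> s / 2)) (at s)" for s
    by (rule DERIV_cong[OF lorentz_has_deriv[OF dot_gamma_deriv const]])
      (simp add: frenet lorentz_simps g_xi n_xi mu lorentz_def[of _ 0] algebra_simps)
  have mu_eq: "?\<mu> = (\<lambda>s. - 1 / (2 * (\<gamma> s \<bullet>\<^sub>L \<xi>)))"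
    using mu(1) by (auto simp: g_xi)
  \<comment> \<open>Differentiability of the Blaschke invariant is read off from
    \<open>\<mu> = - 1 / (2 * (\<gamma> \<bullet>\<^sub>L \<xi>))\<close>.\<close>
  have dmu: "(?\<mu> has_real_derivative ?d s) (at s)" for s
  proof -
    define a where "a s = \<gamma> s \<bullet>\<^sub>L \<xi>" for s
    have a: "a s = - (1 / (2 * ?\<mu> s))" by (simp add: a_def g_xi)
    then have "a s \<noteq> 0" using mu(1)[of s] by simp
    moreover have "(a has_real_derivative ?d s / (2 * (?\<mu> s)\<^sup>2)) (at s)"
      using d1 by (simp add: a_def[abs_def])
    ultimately have "((\<lambda>s. - 1 / (2 * a s)) has_real_derivative
        2 * (?d s / (2 * (?\<mu> s)\<^sup>2)) / (2 * a s * (2 * a s))) (at s)"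
      by (auto intro!: derivative_eq_intros)
    moreover have "2 * (?d s / (2 * (?\<mu> s)\<^sup>2)) / (2 * a s * (2 * a s)) = ?d s"
      using mu(1)[of s] by (simp add: a power2_eq_square)
    moreover have "(\<lambda>s. - 1 / (2 * a s)) = ?\<mu>"
      by (rule ext) (use mu(1) in \<open>simp add: a_def g_xi\<close>)
    ultimately show ?thesis by (simp only:)
  qed
  have d_eq: "?d = (\<lambda>s. 2 * (?\<mu> s)\<^sup>2 * (dot \<gamma> s \<bullet>\<^sub>L \<xi>))"
  proof
    show "?d s = 2 * (?\<mu> s)\<^sup>2 * (dot \<gamma> s \<bullet>\<^sub>L \<xi>)" for s using mu(1)[of s] by (simp add: t_xi)
  qed
  have ddmu: "(?d has_real_derivative
     2 * (?d s)\<^sup>2 / ?\<mu> s - ?\<mu> s - 2 * lam * (?\<mu> s)^4 - (?\<mu> s)^5) (at s)" for s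
  proof -
    have "((\<lambda>s. 2 * (?\<mu> s)\<^sup>2 * (dot \<gamma> s \<bullet>\<^sub>L \<xi>)) has_real_derivative
       2 * (2 * ?\<mu> s * ?d s) * (dot \<gamma> s \<bullet>\<^sub>L \<xi>)
       + 2 * (?\<mu> s)\<^sup>2 * (- (1 / (2 * ?\<mu> s)) - (?\<mu> s)\<^sup>2 * (lam + ?\<mu> s / 2))) (at s)"
      by (auto intro!: derivative_eq_intros dmu d2)
    moreover have "2 * (2 * ?\<mu> s * ?d s) * (dot \<gamma> s \<bullet>\<^sub>L \<xi>)
       + 2 * (?\<mu> s)\<^sup>2 * (- (1 / (2 * ?\<mu> s)) - (?\<mu> s)\<^sup>2 * (lam + ?\<mu> s / 2))
       = 2 * (?d s)\<^sup>2 / ?\<mu> s - ?\<mu> s - 2 * lam * (?\<mu> s)^4 - (?\<mu> s)^5"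
      using mu(1)[of s] by (simp add: t_xi field_simps eval_nat_numeral)
    ultimately show ?thesis using d_eq by simp
  qed
  \<comment> \<open>In the frame the norm of \<open>\<xi>\<close> is
    \<open>B\<^sup>2 + C\<^sup>2 - A\<^sup>2\<close>; the first integral evaluates it at time
    \<open>0\<close>.\<close>
  have xx: "\<xi> \<bullet>\<^sub>L \<xi> = c"
  proof -
    have m: "?\<mu> 0 \<noteq> 0" using mu(1)[of 0] by simp
    have "\<xi> \<bullet>\<^sub>L \<xi> = (1 / (2 * ?\<mu> 0)) * (\<gamma> 0 \<bullet>\<^sub>L \<xi>) + (?d 0 / (2 * (?\<mu> 0)\<^sup>2)) * (dot \<gamma> 0 \<bullet>\<^sub>L \<xi>)
        - (lam + ?\<mu> 0 / 2) * (n 0 \<bullet>\<^sub>L \<xi>)"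
      by (subst (1) xi[of 0]) (simp add: lorentz_simps)
    also have "\<dots> = - (1 / (2 * ?\<mu> 0))\<^sup>2 + (?d 0)\<^sup>2 / (2 * (?\<mu> 0)\<^sup>2)\<^sup>2 + (lam + ?\<mu> 0 / 2)\<^sup>2"
      unfolding g_xi t_xi n_xi by (simp add: power2_eq_square algebra_simps)
    also have "\<dots> = c"
      unfolding ode Q_def using m by (simp add: field_simps) algebra
    finally show ?thesis .
  qed
  then show "\<xi> \<bullet>\<^sub>L \<xi> = c" .
  show bf: "blaschke_flow lam c ?\<mu> ?d"
    by unfold_locales (use mu(1) dmu ddmu ode xx assms(5) in auto)
  interpret blaschke_flow lam c ?\<mu> ?d by (rule bf)
  show "\<gamma> s \<bullet>\<^sub>L \<xi> = - A s" by (simp add: g_xi A_def)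
  show "\<xi> = A s *\<^sub>R \<gamma> s + B s *\<^sub>R dot \<gamma> s - C s *\<^sub>R (\<gamma> s \<times>\<^sub>L dot \<gamma> s)"
    using xi[of s] by (simp add: A_def B_def C_def n_def)
qed

text \<open>Closedness makes \<open>\<mu>\<close> periodic through
  \<open>\<gamma> \<bullet>\<^sub>L \<xi> = - A\<close>, and then
  \<open>no_periodic_solution\<close> kills \<open>\<phi>\<close> wherever \<open>\<mu>'\<close> is
  nonzero. The null vector is chosen so that \<open>\<phi>\<close> survives at one such
  time.\<close>

lemma no_BS_string: "\<not> BS_string I \<gamma>"
proof
  assume bs: "BS_string I \<gamma>"
  then obtain lam c \<xi> where bc: "B_curve_with lam c I \<gamma>" and mom: "\<forall>s\<in>I. momentum_at lam \<gamma> s = \<xi>"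
    and xi: "\<xi> \<bullet>\<^sub>L \<xi> > 0" and per: "periodic_on I \<gamma>"
    unfolding BS_string_def BS_curve_def has_momentum_def closed_curve_def by blast
  have arc: "hyp_arc I \<gamma>"
    using bc unfolding B_curve_with_def convex_curve_def hyp_curve_def by blast
  have I: "I = UNIV"
    using periodic_on_UNIV[of I \<gamma>] arc per unfolding hyp_arc_def by blast
  obtain T where T: "T > 0" "\<And>s. \<gamma> (s + T) = \<gamma> s"
    using per unfolding periodic_on_def I by blast
  interpret hyp_line \<gamma>
    using arc unfolding I hyp_arc_def hyp_plane_def by unfold_locales auto
  let ?\<mu> = "blaschke \<gamma>" and ?d = "dot (blaschke \<gamma>)"
  have pos: "geodesic_curvature \<gamma> s > 0"
    and ode: "(?d s)\<^sup>2 = - (?\<mu> s)\<^sup>2 * Q lam c (?\<mu> s)" for s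
    using bc unfolding B_curve_with_def convex_curve_def I by auto
  have mom': "momentum_at lam \<gamma> s = \<xi>" for s using mom I by simp
  note facts = momentum_blaschke_flow[OF hyp_line_axioms pos ode mom' xi]
  interpret blaschke_flow lam c ?\<mu> ?d by (rule facts)
  have g_xi: "\<gamma> s \<bullet>\<^sub>L \<xi> = - A s" and xi_eq: "\<xi> = A s *\<^sub>R \<gamma> s + B s *\<^sub>R dot \<gamma> s - C s *\<^sub>R n s" for s
    using facts(3,4)[of s] by (simp_all add: n_def)
  have mu_per: "?\<mu> (s + T) = ?\<mu> s" for s
  proof -
    have "A (s + T) = A s" using g_xi[of s] g_xi[of "s + T"] T(2)[of s] by simp
    then show ?thesis using mu_nz by (simp add: A_def field_simps)
  qed
  obtain s0 s1 where nonconst: "?\<mu> s0 \<noteq> ?\<mu> s1"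
    using bc unfolding B_curve_with_def I constant_on_def by blast
  obtain s where s: "?d s \<noteq> 0"
  proof (rule ccontr)
    assume "\<not> thesis"
    then have "\<And>s. ?d s = 0" using that by blast
    then have "\<And>s. (?\<mu> has_real_derivative 0) (at s)" using mu_deriv by metis
    then show False using DERIV_isconst_all nonconst by blast
  qed
  \<comment> \<open>On the plane orthogonal to \<open>\<xi>\<close> the map
    \<open>\<xi> \<times>\<^sub>L _\<close> squares to \<open>c\<close>, so applying it plus
    \<open>sqrt c\<close> to \<open>\<xi> \<times>\<^sub>L \<gamma> s\<close> lands in the
    eigenspace of \<open>sqrt c\<close>.\<close>
  define l where "l = sqrt c *\<^sub>R (\<xi> \<times>\<^sub>L \<gamma> s) + \<xi> \<times>\<^sub>L (\<xi> \<times>\<^sub>L \<gamma> s)"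
  have l_xi: "\<xi> \<bullet>\<^sub>L l = 0" by (simp add: l_def lorentz_simps lcross_orth)
  have eig: "\<xi> \<times>\<^sub>L l = sqrt c *\<^sub>R l"
  proof -
    have "\<xi> \<times>\<^sub>L (\<xi> \<times>\<^sub>L (\<xi> \<times>\<^sub>L \<gamma> s)) = c *\<^sub>R (\<xi> \<times>\<^sub>L \<gamma> s)"
      unfolding lcross_triple[of \<xi> \<xi> "\<xi> \<times>\<^sub>L \<gamma> s"] by (simp add: lcross_orth facts(2))
    moreover have "sqrt c * sqrt c = c" using c_pos by simp
    ultimately show ?thesis by (simp add: l_def lcross_linear scaleR_add_right add.commute)
  qed
  define \<phi> where "\<phi> t = \<gamma> t \<bullet>\<^sub>L l" for t
  have "(\<phi> has_real_derivative (sqrt c * C t - A t * B t) / (\<rho> t)\<^sup>2 * \<phi> t) (at t)" for t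
  proof -
    let ?f = "dot \<gamma> t \<bullet>\<^sub>L l" and ?\<nu> = "n t \<bullet>\<^sub>L l"
    \<comment> \<open>Orthogonality to \<open>\<xi>\<close> and the eigenvector equation are two
      linear relations for \<open>?f\<close> and \<open>?\<nu>\<close>; eliminating
      \<open>?\<nu>\<close> gives the derivative of \<open>\<phi>\<close>.\<close>
    have "0 = A t * \<phi> t + B t * ?f - C t * ?\<nu>"
      using l_xi unfolding xi_eq[of t] \<phi>_def by (simp add: lorentz_simps)
    moreover have "sqrt c * \<phi> t = B t * ?\<nu> + C t * ?f"
    proof -
      have "\<gamma> t \<times>\<^sub>L \<xi> = B t *\<^sub>R n t - C t *\<^sub>R (\<gamma> t \<times>\<^sub>L n t)"
        unfolding xi_eq[of t] by (simp add: lcross_linear n_def)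
      also have "\<gamma> t \<times>\<^sub>L n t = - dot \<gamma> t"
        unfolding n_def lcross_triple by (simp add: on_plane velocity_orth)
      finally have "(\<gamma> t \<times>\<^sub>L \<xi>) \<bullet>\<^sub>L l = B t * ?\<nu> + C t * ?f" by (simp add: lorentz_simps)
      moreover have "(\<gamma> t \<times>\<^sub>L \<xi>) \<bullet>\<^sub>L l = sqrt c * \<phi> t"
        by (metis lcross_rotate eig lorentz_simps(3) lorentz_commute \<phi>_def)
      ultimately show ?thesis by simp
    qed
    ultimately have "(sqrt c * C t - A t * B t) * \<phi> t = ((B t)\<^sup>2 + (C t)\<^sup>2) * ?f" by algebra
    then have "(sqrt c * C t - A t * B t) / (\<rho> t)\<^sup>2 * \<phi> t = ?f"
      unfolding BC_rho using rho_pos[of t] by (simp add: field_simps)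
    then show ?thesis
      unfolding \<phi>_def using lorentz_has_deriv[OF gamma_deriv[of t] has_vector_derivative_const[where c = l]]
      by (simp add: lorentz_def[of _ 0])
  qed
  then have "\<phi> s = 0"
    using no_periodic_solution[of T s0 s1 \<phi> s, OF mu_per T(1) nonconst] s T(2) by (simp add: \<phi>_def)
  \<comment> \<open>The first summand of \<open>l\<close> is orthogonal to
    \<open>\<gamma> s\<close>; the triple product formula turns the second into
    \<open>- c - (A s)\<^sup>2\<close>.\<close>
  moreover have "\<phi> s = - (\<rho> s)\<^sup>2"
    unfolding \<phi>_def l_def lcross_triple lorentz_simps rho_sq lcross_orth facts(2)
    by (simp add: on_plane g_xi lorentz_commute[of \<xi>] power2_eq_square)
  ultimately show False using rho_pos[of s] by simp
qed

section \<open>Smoothness\<close>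

text \<open>Iterated derivatives are controlled through an algebra of functions stable under derivation.\<close>

inductive_set fun_alg :: "(real \<Rightarrow> real) set \<Rightarrow> (real \<Rightarrow> real) set" for G where
  gen: "f \<in> G \<Longrightarrow> f \<in> fun_alg G"
| const: "(\<lambda>_. k) \<in> fun_alg G"
| add: "f \<in> fun_alg G \<Longrightarrow> h \<in> fun_alg G \<Longrightarrow> (\<lambda>s. f s + h s) \<in> fun_alg G"
| mult: "f \<in> fun_alg G \<Longrightarrow> h \<in> fun_alg G \<Longrightarrow> (\<lambda>s. f s * h s) \<in> fun_alg G"

lemma fun_alg_deriv:
  assumes G: "\<And>f. f \<in> G \<Longrightarrow> \<exists>f'\<in>fun_alg G. \<forall>s. (f has_real_derivative f' s) (at s)"
    and "f \<in> fun_alg G"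
  shows "\<exists>f'\<in>fun_alg G. \<forall>s. (f has_real_derivative f' s) (at s)"
  using assms(2)
proof induction
  case (gen f)
  then show ?case by (rule G)
next
  case (const k)
  show ?case by (rule bexI[of _ "\<lambda>_. 0"]) (auto intro: fun_alg.const)
next
  case (add f h)
  then obtain f' h' where "f' \<in> fun_alg G" "h' \<in> fun_alg G"
    "\<forall>s. (f has_real_derivative f' s) (at s)" "\<forall>s. (h has_real_derivative h' s) (at s)" by blast
  then show ?case
    by (intro bexI[of _ "\<lambda>s. f' s + h' s"]) (auto intro: fun_alg.add DERIV_add)
next
  case (mult f h)
  then obtain f' h' where "f' \<in> fun_alg G" "h' \<in> fun_alg G"
    "\<forall>s. (f has_real_derivative f' s) (at s)" "\<forall>s. (h has_real_derivative h' s) (at s)" by blast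
  with mult show ?case
    by (intro bexI[of _ "\<lambda>s. f' s * h s + h' s * f s"])
      (auto intro: fun_alg.add fun_alg.mult DERIV_mult)
qed

lemma vector_3_eq: "(vector [a, b, d] :: real^3) = a *\<^sub>R axis 1 1 + b *\<^sub>R axis 2 1 + d *\<^sub>R axis 3 1"
  by (simp add: vec_eq_iff forall_3 axis_def)

lemma vector_3_deriv:
  assumes "(f1 has_real_derivative d1) (at s)" "(f2 has_real_derivative d2) (at s)"
    "(f3 has_real_derivative d3) (at s)"
  shows "((\<lambda>s. vector [f1 s, f2 s, f3 s] :: real^3) has_vector_derivative vector [d1, d2, d3]) (at s)"
proof -
  have "((\<lambda>s. f1 s *\<^sub>R axis 1 1 + f2 s *\<^sub>R axis 2 1 + f3 s *\<^sub>R axis 3 1 :: real^3)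
      has_vector_derivative (f1 s *\<^sub>R 0 + d1 *\<^sub>R axis 1 1) + (f2 s *\<^sub>R 0 + d2 *\<^sub>R axis 2 1)
        + (f3 s *\<^sub>R 0 + d3 *\<^sub>R axis 3 1)) (at s)"
    by (intro has_vector_derivative_add has_vector_derivative_scaleR assms has_vector_derivative_const)
  then show ?thesis by (simp add: vector_3_eq)
qed

lemma dot_vector_3:
  assumes "\<And>s. (f1 has_real_derivative d1 s) (at s)" "\<And>s. (f2 has_real_derivative d2 s) (at s)"
    "\<And>s. (f3 has_real_derivative d3 s) (at s)"
  shows "dot (\<lambda>s. vector [f1 s, f2 s, f3 s] :: real^3) = (\<lambda>s. vector [d1 s, d2 s, d3 s])"
  unfolding dot_def[abs_def] by (intro ext vector_derivative_at vector_3_deriv assms)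

text \<open>Vectors with components in the algebra are differentiable and closed under
  \<open>dot\<close>, so all iterates stay among them.\<close>

lemma fun_alg_smooth:
  assumes G: "\<And>f. f \<in> G \<Longrightarrow> \<exists>f'\<in>fun_alg G. \<forall>s. (f has_real_derivative f' s) (at s)"
    and f: "f1 \<in> fun_alg G" "f2 \<in> fun_alg G" "f3 \<in> fun_alg G"
  shows "smooth_curve_on UNIV (\<lambda>s. vector [f1 s, f2 s, f3 s] :: real^3)"
proof -
  define v :: "(real \<Rightarrow> real) \<Rightarrow> (real \<Rightarrow> real) \<Rightarrow> (real \<Rightarrow> real) \<Rightarrow> real \<Rightarrow> real^3"
    where "v h1 h2 h3 = (\<lambda>s. vector [h1 s, h2 s, h3 s])" for h1 h2 h3
  define V where "V = {v h1 h2 h3 | h1 h2 h3. h1 \<in> fun_alg G \<and> h2 \<in> fun_alg G \<and> h3 \<in> fun_alg G}"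
  have V: "dot \<gamma> \<in> V \<and> (\<forall>s. \<gamma> differentiable (at s))" if mem: "\<gamma> \<in> V" for \<gamma>
  proof -
    obtain h1 h2 h3 where h: "h1 \<in> fun_alg G" "h2 \<in> fun_alg G" "h3 \<in> fun_alg G"
      and \<gamma>: "\<gamma> = v h1 h2 h3" using mem unfolding V_def by blast
    obtain d1 where d1: "d1 \<in> fun_alg G" "\<forall>s. (h1 has_real_derivative d1 s) (at s)"
      using fun_alg_deriv[OF G h(1)] by blast
    obtain d2 where d2: "d2 \<in> fun_alg G" "\<forall>s. (h2 has_real_derivative d2 s) (at s)"
      using fun_alg_deriv[OF G h(2)] by blast
    obtain d3 where d3: "d3 \<in> fun_alg G" "\<forall>s. (h3 has_real_derivative d3 s) (at s)"
      using fun_alg_deriv[OF G h(3)] by blast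
    note D = d1(2)[rule_format] d2(2)[rule_format] d3(2)[rule_format]
    have "\<gamma> differentiable (at s)" for s
      unfolding \<gamma> v_def using vector_3_deriv[OF D] differentiableI_vector by blast
    moreover have "dot \<gamma> = v d1 d2 d3"
      unfolding \<gamma> v_def by (rule dot_vector_3 D)+
    ultimately show ?thesis using d1(1) d2(1) d3(1) unfolding V_def by blast
  qed
  have "(dot ^^ k) (v f1 f2 f3) \<in> V" for k
  proof (induction k)
    case 0
    then show ?case using f unfolding V_def by auto
  next
    case (Suc k)
    then show ?case using V by simp
  qed
  then show ?thesis unfolding smooth_curve_on_def v_def[symmetric] using V by blast
qed

section \<open>Periodicity of the Blaschke invariant\<close>

text \<open>In this form \<open>Q \<le> 0\<close> reads
  \<open>\<bar>C / \<rho>\<bar> \<le> 1\<close> in terms of \<open>x = \<mu>\<close>, for positive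
  \<open>x\<close> and \<open>c\<close>.\<close>

lemma Q_square: "Q lam c x = (x * (x + 2 * lam))\<^sup>2 - (1 + 4 * c * x\<^sup>2)"
  by (simp add: Q_def power2_eq_square power3_eq_cube power4_eq_xxxx algebra_simps)

text \<open>The assumptions give \<open>(x + 2 * lam)\<^sup>2 \<ge> 4 * c + 1\<close>, and
  \<open>x\<^sup>2 > 1\<close> makes the first square dominate.\<close>

lemma Q_pos_outside:
  assumes c_pos: "c > 0" and "\<bar>x\<bar> > 1" "\<bar>x + 2 * lam\<bar> \<ge> 2 * sqrt c + 1"
  shows "Q lam c x > 0"
proof -
  have x: "x\<^sup>2 > 1" using one_less_power[OF assms(2), of 2] by simp
  have "4 * c + 1 \<le> (2 * sqrt c + 1)\<^sup>2" using c_pos by (simp add: power2_sum power_mult_distrib)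
  also have "\<dots> \<le> \<bar>x + 2 * lam\<bar>\<^sup>2" using assms(3) c_pos by (intro power_mono) auto
  finally have "x\<^sup>2 * (4 * c + 1) \<le> x\<^sup>2 * (x + 2 * lam)\<^sup>2" by (intro mult_left_mono) auto
  moreover have "x\<^sup>2 * (4 * c + 1) = x\<^sup>2 + 4 * c * x\<^sup>2" by (simp add: algebra_simps)
  ultimately show ?thesis unfolding Q_square power_mult_distrib using x by linarith
qed

context blaschke_flow
begin

text \<open>This is \<open>C / \<rho>\<close> as a function of \<open>\<mu>\<close>. It increases
  strictly where \<open>g > 0\<close>, so there the angle determines \<open>\<mu>\<close>.\<close>

definition U where "U x = x * (x + 2 * lam) / sqrt (1 + 4 * c * x\<^sup>2)"

lemma U_mu: "U (\<mu> s) = C s / \<rho> s"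
  unfolding U_def sqrt_mu C_def using mu_nz[of s] rho_pos[of s] by (simp add: field_simps)

lemma U_deriv:
  "(U has_real_derivative g x / ((1 + 4 * c * x\<^sup>2) * sqrt (1 + 4 * c * x\<^sup>2))) (at x)"
proof -
  let ?r = "sqrt (1 + 4 * c * x\<^sup>2)"
  have r: "?r > 0" "?r\<^sup>2 = 1 + 4 * c * x\<^sup>2" using one_plus_pos[of x] by auto
  have "(U has_real_derivative ((2 * x + 2 * lam) * ?r - x * (x + 2 * lam) * (4 * c * x / ?r)) / ?r\<^sup>2) (at x)"
    unfolding U_def[abs_def] using one_plus_pos[of x]
    by (auto intro!: derivative_eq_intros simp: power2_eq_square[of ?r] field_simps)
  moreover have "((2 * x + 2 * lam) * ?r - x * (x + 2 * lam) * (4 * c * x / ?r)) / ?r\<^sup>2 = g x / (?r\<^sup>2 * ?r)"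
  proof -
    have "(2 * x + 2 * lam) * ?r - x * (x + 2 * lam) * (4 * c * x / ?r)
      = ((2 * x + 2 * lam) * ?r\<^sup>2 - x * (x + 2 * lam) * (4 * c * x)) / ?r"
      using r(1) by (simp add: field_simps power2_eq_square)
    also have "(2 * x + 2 * lam) * ?r\<^sup>2 - x * (x + 2 * lam) * (4 * c * x) = g x"
      unfolding r g_def by (simp add: algebra_simps power2_eq_square power3_eq_cube)
    finally show ?thesis by simp
  qed
  ultimately show ?thesis by (simp add: r(2))
qed

lemma U_inj:
  assumes "e > 0" "g e > 0" "x \<ge> e" "y \<ge> e" "U x = U y"
  shows "x = y"
proof -
  have "U x < U y" if "x < y" "x \<ge> e" for x y
  proof (rule DERIV_pos_imp_increasing[OF that(1)])
    show "\<exists>d. (U has_real_derivative d) (at z) \<and> 0 < d" if "x \<le> z" for z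
    proof (intro exI conjI)
      have "g z > 0" using g_mono[of e z] assms(1,2) \<open>x \<ge> e\<close> that by simp
      then show "0 < g z / ((1 + 4 * c * z\<^sup>2) * sqrt (1 + 4 * c * z\<^sup>2))"
        using one_plus_pos[of z] by simp
    qed (rule U_deriv)
  qed
  then show ?thesis using assms by (metis less_irrefl linorder_neqE)
qed

text \<open>The first integral needs \<open>Q \<le> 0\<close>, which fails beyond this
  bound.\<close>

lemma mu_bounded: "\<mu> s \<le> 2 + 2 * sqrt c + 2 * \<bar>lam\<bar>"
proof (rule ccontr)
  assume "\<not> ?thesis"
  then have "Q lam c (\<mu> s) > 0" using c_pos real_sqrt_ge_zero[of c] by (intro Q_pos_outside[OF c_pos]) linarith+
  moreover have "Q lam c (\<mu> s) \<le> 0"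
    using first_integral[of s] mu_pos[of s] zero_le_power2[of "\<mu>' s"]
    by (metis mult_minus_left neg_0_le_iff_le mult_pos_pos not_le zero_less_power)
  ultimately show False by simp
qed

text \<open>As \<open>\<mu>\<close> is determined by the angle of \<open>(C / \<rho>, B / \<rho>)\<close>, the time needed for one full turn does not
  depend on the starting time.\<close>

lemma periodic_solution:
  assumes e: "e > 0" "g e > 0" "\<And>s. e \<le> \<mu> s" and start: "\<mu>' 0 = 0" "C 0 < 0"
  obtains T where "T > 0" "\<And>s. \<mu> (s + T) = \<mu> s"
proof -
  define M where "M = 2 + 2 * sqrt c + 2 * \<bar>lam\<bar>"
  \<comment> \<open>A positive lower bound for the angular velocity, from
    \<open>e \<le> \<mu> s \<le> M\<close>.\<close>
  define w0 where "w0 = e * g e / (1 + 4 * c * M\<^sup>2)"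
  have w0: "w0 > 0" unfolding w0_def using e one_plus_pos by simp
  have w: "w s \<ge> w0" for s
    unfolding w_def w0_def
  proof (rule frac_le)
    show "e * g e \<le> \<mu> s * g (\<mu> s)" using e(1,2) e(3)[of s] g_mono[of e "\<mu> s"] by (intro mult_mono) auto
    then show "0 \<le> \<mu> s * g (\<mu> s)" using e by (meson mult_pos_pos less_imp_le order_trans)
    show "1 + 4 * c * (\<mu> s)\<^sup>2 \<le> 1 + 4 * c * M\<^sup>2"
      using mu_bounded[of s] mu_pos[of s] c_pos unfolding M_def[symmetric]
      by (intro add_left_mono mult_left_mono power_mono) auto
  qed (rule one_plus_pos)
  have "continuous_on UNIV w"
    unfolding w_def[abs_def] g_def
    by (intro continuous_intros mu_continuous) (use one_plus_pos less_irrefl in metis)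
  define \<theta> where "\<theta> s = (LBINT t=0..s. w t)" for s :: real
  have th: "(\<theta> has_real_derivative w s) (at s)" for s
    unfolding \<theta>_def[abs_def] by (rule LBINT_deriv) fact
  have th0: "\<theta> 0 = 0" by (simp add: \<theta>_def zero_ereal_def)
  \<comment> \<open>At time \<open>0\<close> the unit vector is \<open>(-1, 0)\<close>, because
    \<open>B 0 = 0\<close> and \<open>C 0 < 0\<close>; hence the minus sign before the
    cosine.\<close>
  have uv: "C s / \<rho> s = - cos (\<theta> s) \<and> B s / \<rho> s = sin (\<theta> s)" for s
  proof -
    define u v where "u s = C s / \<rho> s" and "v s = B s / \<rho> s" for s
    have u: "(u has_real_derivative v s * w s) (at s)" and v: "(v has_real_derivative - u s * w s) (at s)" for s
      using u_deriv[of s] v_deriv[of s] by (simp_all add: u_def[abs_def] v_def[abs_def])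
    \<comment> \<open>Squared distance between two solutions of the same rotation system: conserved,
      and \<open>0\<close> initially.\<close>
    define F where "F s = (u s + cos (\<theta> s))\<^sup>2 + (v s - sin (\<theta> s))\<^sup>2" for s
    have "(F has_real_derivative 0) (at s)" for s
      unfolding F_def[abs_def]
      by (auto intro!: derivative_eq_intros u v th simp: algebra_simps)
    then have "F s = F 0" using DERIV_isconst_all by blast
    also have "F 0 = 0"
    proof -
      have B0: "B 0 = 0" by (simp add: B_def start)
      then have "(- C 0)\<^sup>2 = (\<rho> 0)\<^sup>2" using BC_rho[of 0] by simp
      then have "- C 0 = \<rho> 0" using start rho_pos[of 0] by (auto intro: power2_eq_imp_eq[of "- C 0" "\<rho> 0"] simp del: power2_minus)
      then have "C 0 = - \<rho> 0" by simp
      then show ?thesis using rho_pos[of 0] by (simp add: F_def u_def v_def B0 th0)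
    qed
    finally show ?thesis by (simp add: F_def u_def v_def sum_power2_eq_zero_iff)
  qed
  \<comment> \<open>Uniform growth makes the angle a bijection of the line, so it can be inverted
    and each full turn is completed.\<close>
  have growth: "\<theta> y - \<theta> x \<ge> w0 * (y - x)" if "x \<le> y" for x y
  proof -
    have "\<theta> x - w0 * x \<le> \<theta> y - w0 * y"
    proof (rule DERIV_nonneg_imp_nondecreasing[OF that])
      show "\<exists>d. ((\<lambda>s. \<theta> s - w0 * s) has_real_derivative d) (at s) \<and> 0 \<le> d" for s
        using w[of s] by (intro exI[of _ "w s - w0"]) (auto intro!: derivative_eq_intros th)
    qed
    then show ?thesis by (simp add: algebra_simps)
  qed
  have mono: "\<theta> x < \<theta> y" if "x < y" for x y
  proof -
    have "w0 * (y - x) > 0" using that w0 by simp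
    then show ?thesis using growth[of x y] that by linarith
  qed
  have inj: "inj \<theta>" by (rule linorder_injI) (use mono in force)
  have cont: "isCont \<theta> s" for s using th DERIV_isCont by blast
  have surj: "\<exists>s. \<theta> s = y" for y
  proof -
    let ?b = "\<bar>y\<bar> / w0"
    have "?b \<ge> 0" "w0 * ?b = \<bar>y\<bar>" using w0 by simp_all
    then have "\<theta> ?b \<ge> y" "\<theta> (- ?b) \<le> y"
      using growth[of 0 ?b] growth[of "- ?b" 0] th0 by (auto simp: algebra_simps)
    then show ?thesis using IVT[of \<theta> "- ?b" y ?b] cont \<open>?b \<ge> 0\<close> by fastforce
  qed
  define \<tau> where "\<tau> = inv \<theta>"
  have tau: "\<theta> (\<tau> y) = y" for y unfolding \<tau>_def using surj[of y] by (auto simp: f_inv_into_f)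
  have tau': "\<tau> (\<theta> s) = s" for s unfolding \<tau>_def by (rule inv_f_f[OF inj])
  have tau_deriv: "(\<tau> has_real_derivative inverse (w (\<tau> y))) (at y)" for y
  proof (rule DERIV_inverse_function[where f = \<theta> and a = "y - 1" and b = "y + 1"])
    have "isCont \<tau> (\<theta> (\<tau> y))"
      by (rule isCont_inverse_function[where f = \<theta> and d = 1]) (auto simp: tau' intro: cont)
    then show "isCont \<tau> y" by (simp add: tau)
    show "w (\<tau> y) \<noteq> 0" using w[of "\<tau> y"] w0 by simp
    show "(\<theta> has_real_derivative w (\<tau> y)) (at (\<tau> y))" by (rule th)
  qed (simp_all add: tau)
  \<comment> \<open>The time one full turn after \<open>s\<close>: equal angles give equal
    \<open>U\<close>, hence equal \<open>\<mu>\<close>.\<close>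
  define \<sigma> where "\<sigma> s = \<tau> (\<theta> s + 2 * pi)" for s
  have sigma: "\<mu> (\<sigma> s) = \<mu> s" for s
  proof -
    have "U (\<mu> (\<sigma> s)) = U (\<mu> s)" unfolding U_mu using uv by (simp add: \<sigma>_def tau)
    then show ?thesis by (rule U_inj[OF e(1,2) e(3) e(3)])
  qed
  \<comment> \<open>The derivative of \<open>\<sigma>\<close> is
    \<open>w s / w (\<sigma> s)\<close>, which is \<open>1\<close> because \<open>w\<close> depends
    on \<open>\<mu>\<close> alone.\<close>
  have "((\<lambda>s. \<sigma> s - s) has_real_derivative 0) (at s)" for s
  proof -
    have "(\<sigma> has_real_derivative inverse (w (\<sigma> s)) * w s) (at s)"
      unfolding \<sigma>_def[abs_def] using DERIV_chain2[OF tau_deriv DERIV_add[OF th DERIV_const]] by simp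
    moreover have "w (\<sigma> s) = w s" "w s \<noteq> 0" using sigma w[of s] w0 by (auto simp: w_def)
    ultimately have "(\<sigma> has_real_derivative 1) (at s)" by simp
    from DERIV_diff[OF this DERIV_ident] show ?thesis by simp
  qed
  then have const: "\<sigma> s - s = \<sigma> 0 - 0" for s using DERIV_isconst_all by blast
  have shift: "\<sigma> s = s + \<sigma> 0" for s using const[of s] by linarith
  have sigma_pos: "\<sigma> 0 > 0"
  proof (rule ccontr)
    assume "\<not> \<sigma> 0 > 0"
    then have "\<theta> (\<sigma> 0) \<le> \<theta> 0" using mono[of "\<sigma> 0" 0] by (cases "\<sigma> 0 = 0") auto
    then show False using pi_gt_zero by (simp add: \<sigma>_def tau th0 del: pi_gt_zero)
  qed
  show ?thesis
  proof (rule that)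
    show "\<mu> (s + \<sigma> 0) = \<mu> s" for s using sigma[of s] by (subst shift[symmetric])
  qed (rule sigma_pos)
qed

end

section \<open>The model curves\<close>

locale blaschke_curve = blaschke_flow +
  fixes \<Theta> :: "real \<Rightarrow> real"
  assumes Theta_deriv': "(\<Theta> has_real_derivative sqrt c * C s / (\<rho> s)\<^sup>2) (at s)"
begin

definition K where "K = sqrt c"
text \<open>Coordinates about the geodesic orthogonal to the momentum: \<open>A / K\<close> and
  \<open>\<rho> / K\<close> are the hyperbolic sine and cosine of the distance to it, and
  \<open>\<Theta>\<close> is the position along it.\<close>

definition \<gamma> :: "real \<Rightarrow> real^3" where
  "\<gamma> = (\<lambda>s. vector [\<rho> s * cosh (\<Theta> s) / K, \<rho> s * sinh (\<Theta> s) / K, A s / K])"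
definition \<gamma>' :: "real \<Rightarrow> real^3" where
  "\<gamma>' = (\<lambda>s. vector [(K * C s * sinh (\<Theta> s) - A s * B s * cosh (\<Theta> s)) / (K * \<rho> s),
    (K * C s * cosh (\<Theta> s) - A s * B s * sinh (\<Theta> s)) / (K * \<rho> s), - B s / K])"

lemma Theta_deriv: "(\<Theta> has_real_derivative K * C s / (\<rho> s)\<^sup>2) (at s)"
  unfolding K_def by (rule Theta_deriv')

lemma K_sqrt: "K > 0" "K\<^sup>2 = c" "K \<noteq> 0"
  using c_pos by (simp_all add: K_def)

lemma rho_nz: "\<rho> s \<noteq> 0"
  using rho_pos[of s] by simp

lemma dot_curve: "dot \<gamma> = \<gamma>'"
proof -
  have "((\<lambda>s. \<rho> s * cosh (\<Theta> s) / K) has_real_derivative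
      (K * C s * sinh (\<Theta> s) - A s * B s * cosh (\<Theta> s)) / (K * \<rho> s)) (at s)" for s
    using K_sqrt(3) rho_nz[of s]
    by (auto intro!: derivative_eq_intros rho_deriv Theta_deriv simp: field_simps power2_eq_square)
  moreover have "((\<lambda>s. \<rho> s * sinh (\<Theta> s) / K) has_real_derivative
      (K * C s * cosh (\<Theta> s) - A s * B s * sinh (\<Theta> s)) / (K * \<rho> s)) (at s)" for s
    using K_sqrt(3) rho_nz[of s]
    by (auto intro!: derivative_eq_intros rho_deriv Theta_deriv simp: field_simps power2_eq_square)
  moreover have "((\<lambda>s. A s / K) has_real_derivative - B s / K) (at s)" for s
    by (rule DERIV_cdivide A_deriv)+
  ultimately show ?thesis unfolding \<gamma>_def \<gamma>'_def by (rule dot_vector_3)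
qed

lemma normal_curve:
  "\<gamma> s \<times>\<^sub>L \<gamma>' s = vector [(A s * C s * cosh (\<Theta> s) + K * B s * sinh (\<Theta> s)) / (K * \<rho> s),
     (A s * C s * sinh (\<Theta> s) + K * B s * cosh (\<Theta> s)) / (K * \<rho> s), C s / K]"
proof -
  have r: "(\<rho> s)\<^sup>2 = K\<^sup>2 + (A s)\<^sup>2" by (simp add: rho_sq K_sqrt(2))
  have h: "(cosh (\<Theta> s))\<^sup>2 = (sinh (\<Theta> s))\<^sup>2 + 1" by (rule cosh_square_eq)
  show ?thesis
    unfolding \<gamma>_def \<gamma>'_def using K_sqrt(3) rho_nz[of s]
    apply (simp add: vec_eq_iff forall_3 lcross_nth field_simps)
    using r h apply (intro conjI; algebra)
    done
qed

lemma accel_curve: "dot \<gamma>' s = \<gamma> s + (\<mu> s)\<^sup>2 *\<^sub>R (\<gamma> s \<times>\<^sub>L \<gamma>' s)"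
proof -
  have r: "(\<rho> s)\<^sup>2 = K\<^sup>2 + (A s)\<^sup>2" "(B s)\<^sup>2 + (C s)\<^sup>2 = (\<rho> s)\<^sup>2" for s
    by (simp_all add: rho_sq K_sqrt(2) BC_rho[unfolded rho_sq])
  \<comment> \<open>The first two components differ by exchanging \<open>cosh\<close> and
    \<open>sinh\<close>, so one computation treats any pair of functions that are each other's
    derivative.\<close>
  have d: "((\<lambda>s. (K * C s * f (\<Theta> s) - A s * B s * h (\<Theta> s)) / (K * \<rho> s)) has_real_derivative
     \<rho> s * h (\<Theta> s) / K + (\<mu> s)\<^sup>2 * ((A s * C s * h (\<Theta> s) + K * B s * f (\<Theta> s)) / (K * \<rho> s))) (at s)"
    if f: "\<And>x. (f has_real_derivative h x) (at x)" and h: "\<And>x. (h has_real_derivative f x) (at x)"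
    for f h :: "real \<Rightarrow> real" and s
  proof -
    have f': "((\<lambda>s. f (\<Theta> s)) has_real_derivative h (\<Theta> s) * (K * C s / (\<rho> s)\<^sup>2)) (at s)"
     and h': "((\<lambda>s. h (\<Theta> s)) has_real_derivative f (\<Theta> s) * (K * C s / (\<rho> s)\<^sup>2)) (at s)" for s
      by (rule DERIV_chain2[OF f Theta_deriv], rule DERIV_chain2[OF h Theta_deriv])
    define D where "D = K * ((\<mu> s)\<^sup>2 * B s) * f (\<Theta> s) + K * C s * (h (\<Theta> s) * (K * C s / (\<rho> s)\<^sup>2))
      - ((- B s) * B s + A s * (- A s - (\<mu> s)\<^sup>2 * C s)) * h (\<Theta> s)
      - A s * B s * (f (\<Theta> s) * (K * C s / (\<rho> s)\<^sup>2))"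
    have "((\<lambda>s. (K * C s * f (\<Theta> s) - A s * B s * h (\<Theta> s)) / (K * \<rho> s)) has_real_derivative
       (D * (K * \<rho> s) - (K * C s * f (\<Theta> s) - A s * B s * h (\<Theta> s)) * (K * (- A s * B s / \<rho> s)))
         / ((K * \<rho> s) * (K * \<rho> s))) (at s)"
      unfolding D_def using K_sqrt(3) rho_nz[of s]
      by (auto intro!: derivative_eq_intros A_deriv B_deriv C_deriv rho_deriv f' h' simp: algebra_simps)
    moreover have "(D * (K * \<rho> s) - (K * C s * f (\<Theta> s) - A s * B s * h (\<Theta> s)) * (K * (- A s * B s / \<rho> s)))
         / ((K * \<rho> s) * (K * \<rho> s))
      = \<rho> s * h (\<Theta> s) / K + (\<mu> s)\<^sup>2 * ((A s * C s * h (\<Theta> s) + K * B s * f (\<Theta> s)) / (K * \<rho> s))"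
      unfolding D_def using K_sqrt(3) rho_nz[of s]
      apply (simp add: field_simps)
      using r[of s] apply algebra
      done
    ultimately show ?thesis by simp
  qed
  have "((\<lambda>s. - B s / K) has_real_derivative A s / K + (\<mu> s)\<^sup>2 * (C s / K)) (at s)" for s
    using K_sqrt(3) by (auto intro!: derivative_eq_intros B_deriv simp: field_simps)
  note e = this
  have sh: "(sinh has_real_derivative cosh x) (at x)" "(cosh has_real_derivative sinh x) (at x)" for x :: real
    by (auto intro!: derivative_eq_intros)
  have "dot \<gamma>' s = vector [\<rho> s * cosh (\<Theta> s) / K + (\<mu> s)\<^sup>2 * ((A s * C s * cosh (\<Theta> s) + K * B s * sinh (\<Theta> s)) / (K * \<rho> s)),
     \<rho> s * sinh (\<Theta> s) / K + (\<mu> s)\<^sup>2 * ((A s * C s * sinh (\<Theta> s) + K * B s * cosh (\<Theta> s)) / (K * \<rho> s)),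
     A s / K + (\<mu> s)\<^sup>2 * (C s / K)]"
    unfolding \<gamma>'_def using dot_vector_3[OF d[OF sh] d[OF sh(2,1)] e] by (rule fun_cong)
  then show ?thesis unfolding normal_curve
    by (simp add: vec_eq_iff forall_3 \<gamma>_def)
qed

lemma curve_on_plane: "\<gamma> s \<in> hyp_plane"
proof -
  have "K\<^sup>2 * (\<gamma> s \<bullet>\<^sub>L \<gamma> s) = - (\<rho> s)\<^sup>2 * ((cosh (\<Theta> s))\<^sup>2 - (sinh (\<Theta> s))\<^sup>2) + (A s)\<^sup>2"
    unfolding \<gamma>_def lorentz_def using K_sqrt(3) by (simp add: field_simps power2_eq_square)
  also have "\<dots> = K\<^sup>2 * (-1)" by (simp add: cosh_square_eq rho_sq K_sqrt(2))
  finally have "\<gamma> s \<bullet>\<^sub>L \<gamma> s = -1" using K_sqrt(3) by (metis mult_left_cancel power_not_zero)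
  moreover have "\<gamma> s $ 1 > 0" unfolding \<gamma>_def using rho_pos K_sqrt(1) cosh_real_pos by simp
  ultimately show ?thesis by (simp add: hyp_plane_def)
qed

lemma curve_unit_speed: "\<gamma>' s \<bullet>\<^sub>L \<gamma>' s = 1"
proof -
  have r: "(\<rho> s)\<^sup>2 = K\<^sup>2 + (A s)\<^sup>2" "(B s)\<^sup>2 + (C s)\<^sup>2 = (\<rho> s)\<^sup>2"
    by (simp_all add: rho_sq K_sqrt(2) BC_rho[unfolded rho_sq])
  have h: "(cosh (\<Theta> s))\<^sup>2 = (sinh (\<Theta> s))\<^sup>2 + 1" by (rule cosh_square_eq)
  show ?thesis
    unfolding \<gamma>'_def lorentz_def using K_sqrt(3) rho_nz[of s]
    apply (simp add: field_simps)
    using r h apply algebra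
    done
qed

lemma curve_smooth: "smooth_curve_on UNIV \<gamma>"
proof -
  \<comment> \<open>The algebra has no quotients, so \<open>1 / \<rho>\<close> is a generator of its
    own; the derivatives of all generators are polynomial in them.\<close>
  let ?G = "{\<mu>, A, B, C, \<rho>, \<lambda>s. 1 / \<rho> s, \<lambda>s. cosh (\<Theta> s), \<lambda>s. sinh (\<Theta> s)}"
  have mem: "\<mu> \<in> fun_alg ?G" "A \<in> fun_alg ?G" "B \<in> fun_alg ?G" "C \<in> fun_alg ?G" "\<rho> \<in> fun_alg ?G"
    "(\<lambda>s. 1 / \<rho> s) \<in> fun_alg ?G" "(\<lambda>s. cosh (\<Theta> s)) \<in> fun_alg ?G" "(\<lambda>s. sinh (\<Theta> s)) \<in> fun_alg ?G"
    by (auto intro: fun_alg.gen)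
  note I = fun_alg.mult fun_alg.const fun_alg.add mem
  have "\<exists>f'\<in>fun_alg ?G. \<forall>s. (f has_real_derivative f' s) (at s)" if f: "f \<in> ?G" for f
  proof -
    have d0: "(\<mu> has_real_derivative 2 * (\<mu> s * (\<mu> s * B s))) (at s)" for s
      using mu_deriv[of s] mu_nz[of s] by (simp add: B_def power2_eq_square)
    have d1: "(A has_real_derivative (-1) * B s) (at s)" for s
      using A_deriv by simp
    have d2: "(B has_real_derivative (-1) * A s + (-1) * (\<mu> s * (\<mu> s * C s))) (at s)" for s
      using B_deriv[of s] by (simp add: power2_eq_square mult.assoc)
    have d3: "(C has_real_derivative \<mu> s * (\<mu> s * B s)) (at s)" for s
      using C_deriv[of s] by (simp add: power2_eq_square mult.assoc)
    have d4: "(\<rho> has_real_derivative (-1) * (A s * (B s * (1 / \<rho> s)))) (at s)" for s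
      using rho_deriv[of s] by simp
    have d5: "((\<lambda>s. 1 / \<rho> s) has_real_derivative A s * (B s * (1 / \<rho> s * (1 / \<rho> s * (1 / \<rho> s))))) (at s)" for s
      using rho_nz[of s] by (auto intro!: derivative_eq_intros rho_deriv)
    have d6: "((\<lambda>s. cosh (\<Theta> s)) has_real_derivative K * (sinh (\<Theta> s) * (C s * (1 / \<rho> s * (1 / \<rho> s))))) (at s)" for s
      by (auto intro!: derivative_eq_intros Theta_deriv simp: power2_eq_square)
    have d7: "((\<lambda>s. sinh (\<Theta> s)) has_real_derivative K * (cosh (\<Theta> s) * (C s * (1 / \<rho> s * (1 / \<rho> s))))) (at s)" for s
      by (auto intro!: derivative_eq_intros Theta_deriv simp: power2_eq_square)
    have ex: "\<exists>f'\<in>fun_alg ?G. \<forall>s. (h has_real_derivative f' s) (at s)"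
      if "\<And>s. (h has_real_derivative d s) (at s)" "d \<in> fun_alg ?G" for h d using that by blast
    consider "f = \<mu>" | "f = A" | "f = B" | "f = C" | "f = \<rho>" | "f = (\<lambda>s. 1 / \<rho> s)"
      | "f = (\<lambda>s. cosh (\<Theta> s))" | "f = (\<lambda>s. sinh (\<Theta> s))" using f by blast
    then show ?thesis
    proof cases
      case 1 show ?thesis unfolding 1 by (rule ex, rule d0, intro I)
    next
      case 2 show ?thesis unfolding 2 by (rule ex, rule d1, intro I)
    next
      case 3 show ?thesis unfolding 3 by (rule ex, rule d2, intro I)
    next
      case 4 show ?thesis unfolding 4 by (rule ex, rule d3, intro I)
    next
      case 5 show ?thesis unfolding 5 by (rule ex, rule d4, intro I)
    next
      case 6 show ?thesis unfolding 6 by (rule ex, rule d5, intro I)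
    next
      case 7 show ?thesis unfolding 7 by (rule ex, rule d6, intro I)
    next
      case 8 show ?thesis unfolding 8 by (rule ex, rule d7, intro I)
    qed
  qed
  moreover have "(\<lambda>s. \<rho> s * cosh (\<Theta> s) * (1 / K)) \<in> fun_alg ?G"
    "(\<lambda>s. \<rho> s * sinh (\<Theta> s) * (1 / K)) \<in> fun_alg ?G" "(\<lambda>s. A s * (1 / K)) \<in> fun_alg ?G"
    by (intro I)+
  ultimately show ?thesis unfolding \<gamma>_def using fun_alg_smooth[of ?G] by simp
qed

lemma curvature: "geodesic_curvature \<gamma> s = (\<mu> s)\<^sup>2"
proof (rule geodesic_curvature_eqI)
  show "dot (dot \<gamma>) s = \<gamma> s + (\<mu> s)\<^sup>2 *\<^sub>R (\<gamma> s \<times>\<^sub>L dot \<gamma> s)"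
    unfolding dot_curve by (rule accel_curve)
  have "\<gamma> s \<bullet>\<^sub>L \<gamma> s = -1" using curve_on_plane[of s] by (simp add: hyp_plane_def)
  then have "(\<gamma> s \<times>\<^sub>L \<gamma>' s) \<bullet>\<^sub>L (\<gamma> s \<times>\<^sub>L \<gamma>' s) > 0"
    by (simp add: lcross_norm curve_unit_speed add_nonneg_pos)
  then show "\<gamma> s \<times>\<^sub>L dot \<gamma> s \<noteq> 0" unfolding dot_curve by (auto simp: lorentz_def)
qed

lemma blaschke_curve_eq: "blaschke \<gamma> = \<mu>"
proof
  show "blaschke \<gamma> s = \<mu> s" for s using mu_pos[of s] by (simp add: blaschke_def curvature)
qed

lemma dot_mu: "dot \<mu> = \<mu>'"
  unfolding dot_def[abs_def]
  by (rule ext, rule vector_derivative_at)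
    (rule mu_deriv[unfolded has_real_derivative_iff_has_vector_derivative])

lemma B_curve:
  assumes "T > 0" "\<And>s. \<mu> (s + T) = \<mu> s" "\<mu> s0 \<noteq> \<mu> s1"
  shows "B_curve_with lam c UNIV \<gamma>"
proof -
  have "hyp_arc UNIV \<gamma>"
    unfolding hyp_arc_def dot_curve
    by (intro conjI ballI image_subsetI curve_on_plane curve_smooth curve_unit_speed) simp_all
  moreover have "geodesic_curvature \<gamma> s > 0" for s by (simp add: curvature mu_nz)
  \<comment> \<open>Maximality is immediate: no interval properly contains the whole line.\<close>
  ultimately have "convex_curve UNIV \<gamma>"
    unfolding convex_curve_def hyp_curve_def by blast
  moreover have "periodic_on UNIV \<mu>" unfolding periodic_on_def using assms(1,2) by (intro exI[of _ T]) simp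
  moreover have "\<not> \<mu> constant_on UNIV" using assms(3) unfolding constant_on_def by (metis UNIV_I)
  ultimately show ?thesis
    unfolding B_curve_with_def blaschke_curve_eq dot_mu using first_integral by simp
qed

lemma momentum: "momentum_at lam \<gamma> s = vector [0, 0, - sqrt c]"
proof -
  have r: "(\<rho> s)\<^sup>2 = K\<^sup>2 + (A s)\<^sup>2" "(B s)\<^sup>2 + (C s)\<^sup>2 = (\<rho> s)\<^sup>2"
    by (simp_all add: rho_sq K_sqrt(2) BC_rho[unfolded rho_sq])
  have "momentum_at lam \<gamma> s = A s *\<^sub>R \<gamma> s + B s *\<^sub>R \<gamma>' s - C s *\<^sub>R (\<gamma> s \<times>\<^sub>L \<gamma>' s)"
    by (simp add: momentum_at_def Let_def blaschke_curve_eq dot_curve dot_mu A_def B_def C_def)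
  also have "\<dots> = vector [0, 0, - K]"
    unfolding normal_curve unfolding \<gamma>_def \<gamma>'_def using K_sqrt(3) rho_nz[of s]
    apply (simp add: vec_eq_iff forall_3 field_simps)
    using r apply (intro conjI; algebra)
    done
  finally show ?thesis by (simp add: K_def)
qed

end

section \<open>The given solution and the roots of the quartic\<close>

lemma mu_solution_first_integral:
  assumes "is_mu_solution lam e2 \<mu>" "e2 > 0"
  shows "(dot \<mu> s)\<^sup>2 = - (\<mu> s)\<^sup>2 * Q lam (c_mod lam e2) (\<mu> s)"
proof -
  let ?c = "c_mod lam e2"
  have pos: "\<mu> s > 0" and d: "(\<mu> has_real_derivative dot \<mu> s) (at s)"
    and d2: "(dot \<mu> has_real_derivative
          (2 * (dot \<mu> s)\<^sup>2 / \<mu> s - \<mu> s - 2 * lam * (\<mu> s)^4 - (\<mu> s)^5)) (at s)" for s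
    using assms(1) unfolding is_mu_solution_def by auto
  \<comment> \<open>The first integral divided by \<open>\<mu>^4\<close>, without its constant term;
    \<open>E\<close> is conserved, and \<open>c_mod\<close> is the value of \<open>c\<close> for
    which the initial point is a root.\<close>
  define E where "E s = (dot \<mu> s)\<^sup>2 / (\<mu> s)^4 + (\<mu> s)\<^sup>2 + 4 * lam * \<mu> s - 1 / (\<mu> s)\<^sup>2" for s
  have E: "(dot \<mu> s)\<^sup>2 + (\<mu> s)\<^sup>2 * Q lam ?c (\<mu> s) = (\<mu> s)^4 * (E s + 4 * (lam\<^sup>2 - ?c))" for s
    using pos[of s] unfolding E_def Q_def by (simp add: field_simps eval_nat_numeral)
  have "(E has_real_derivative 0) (at s)" for s
  proof -
    have nz: "\<mu> s \<noteq> 0" using pos[of s] by simp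
    have "(E has_real_derivative
      (2 * dot \<mu> s * (2 * (dot \<mu> s)\<^sup>2 / \<mu> s - \<mu> s - 2 * lam * (\<mu> s)^4 - (\<mu> s)^5) * (\<mu> s)^4
        - (dot \<mu> s)\<^sup>2 * (4 * (\<mu> s)^3 * dot \<mu> s)) / ((\<mu> s)^4 * (\<mu> s)^4)
      + 2 * \<mu> s * dot \<mu> s + 4 * lam * dot \<mu> s + 2 * \<mu> s * dot \<mu> s / ((\<mu> s)\<^sup>2 * (\<mu> s)\<^sup>2)) (at s)"
      unfolding E_def[abs_def] using nz by (auto intro!: derivative_eq_intros d d2 simp: mult_ac)
    moreover have "(2 * dot \<mu> s * (2 * (dot \<mu> s)\<^sup>2 / \<mu> s - \<mu> s - 2 * lam * (\<mu> s)^4 - (\<mu> s)^5) * (\<mu> s)^4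
        - (dot \<mu> s)\<^sup>2 * (4 * (\<mu> s)^3 * dot \<mu> s)) / ((\<mu> s)^4 * (\<mu> s)^4)
      + 2 * \<mu> s * dot \<mu> s + 4 * lam * dot \<mu> s + 2 * \<mu> s * dot \<mu> s / ((\<mu> s)\<^sup>2 * (\<mu> s)\<^sup>2) = 0"
      using nz by (simp add: field_simps eval_nat_numeral)
    ultimately show ?thesis by simp
  qed
  then have "E s = E 0" using DERIV_isconst_all by blast
  moreover have "E 0 + 4 * (lam\<^sup>2 - ?c) = 0"
  proof -
    have "Q lam ?c (\<mu> 0) = 0" "dot \<mu> 0 = 0"
      using assms Q_eq_0_iff_c_mod[of e2 lam ?c] by (auto simp: is_mu_solution_def)
    then have "(\<mu> 0)^4 * (E 0 + 4 * (lam\<^sup>2 - ?c)) = 0" using E[of 0] by simp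
    then show ?thesis using pos[of 0] by simp
  qed
  ultimately show ?thesis using E[of s] by simp
qed

text \<open>Thus the inequality defining \<open>moduli_P\<close> says that \<open>Q\<close> crosses
  zero downwards at \<open>e2\<close>.\<close>

lemma Q_deriv_e2:
  assumes "e2 > 0"
  shows "(Q lam (c_mod lam e2) has_real_derivative 2 * (e2^4 + 2 * lam * e2^3 + 1) / e2) (at e2)"
proof -
  have "(Q lam (c_mod lam e2) has_real_derivative
      4 * e2^3 + 12 * lam * e2\<^sup>2 + 8 * (lam\<^sup>2 - c_mod lam e2) * e2) (at e2)"
    unfolding Q_def[abs_def] by (auto intro!: derivative_eq_intros)
  moreover have "4 * e2^3 + 12 * lam * e2\<^sup>2 + 8 * (lam\<^sup>2 - c_mod lam e2) * e2
      = 2 * (e2^4 + 2 * lam * e2^3 + 1) / e2"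
    unfolding c_mod_def using assms by (simp add: field_simps eval_nat_numeral)
  ultimately show ?thesis by simp
qed

lemma Q_roots_le_4:
  "finite {x. Q lam c x = 0}" "card {x. Q lam c x = 0} \<le> 4"
proof -
  define p where "p = [:-1, 0, 4 * (lam\<^sup>2 - c), 4 * lam, 1:]"
  have p: "poly p x = Q lam c x" for x
    by (simp add: p_def Q_def algebra_simps eval_nat_numeral)
  have "p \<noteq> 0" "degree p = 4" by (simp_all add: p_def)
  then show "finite {x. Q lam c x = 0}" "card {x. Q lam c x = 0} \<le> 4"
    using poly_roots_finite[of p] card_poly_roots_bound[of p] by (simp_all add: p)
qed

text \<open>\<open>Q\<close> is negative at \<open>0\<close>, decreases through \<open>e2\<close>
  and is positive far out on both sides. The sign changes give three further roots, and degree four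
  allows no others.\<close>

lemma Q_four_roots:
  assumes "(lam, e2) \<in> moduli_S"
  obtains e1 e3 e4 where "e1 > e2" "e2 > e3" "e3 > 0" "0 > e4"
    "{x. Q lam (c_mod lam e2) x = 0} = {e1, e2, e3, e4}"
proof -
  let ?c = "c_mod lam e2"
  have e2: "e2 > 0" and k: "e2^4 + 2 * lam * e2^3 + 1 < 0" and c: "?c > 0"
    using assms by (auto simp: moduli_S_def moduli_P_def)
  have cont: "isCont (Q lam ?c) x" for x unfolding Q_def[abs_def] by simp
  have Q0: "Q lam ?c 0 < 0" by (simp add: Q_def)
  have Qe2: "Q lam ?c e2 = 0" using Q_eq_0_iff_c_mod[OF e2] by blast
  have neg: "2 * (e2^4 + 2 * lam * e2^3 + 1) / e2 < 0" using e2 k by (simp add: divide_neg_pos)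
  obtain d where d: "d > 0" "\<And>h. 0 < h \<Longrightarrow> h < d \<Longrightarrow> Q lam ?c (e2 + h) < Q lam ?c e2"
    using DERIV_neg_dec_right[OF Q_deriv_e2[OF e2] neg] by blast
  obtain d' where d': "d' > 0" "\<And>h. 0 < h \<Longrightarrow> h < d' \<Longrightarrow> Q lam ?c (e2 - h) > Q lam ?c e2"
    using DERIV_neg_dec_left[OF Q_deriv_e2[OF e2] neg] by blast
  \<comment> \<open>Beyond the bound of \<open>Q_pos_outside\<close> in both directions, and to the
    right of \<open>e2 + d / 2\<close>.\<close>
  define R where "R = e2 + d + 2 + 2 * sqrt ?c + 2 * \<bar>lam\<bar>"
  have sq: "sqrt ?c > 0" using c by simp
  have R: "Q lam ?c R > 0" "Q lam ?c (- R) > 0"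
    unfolding R_def using sq e2 d(1) by (intro Q_pos_outside[OF c]; linarith)+
  have "\<exists>x>e2 + d / 2. x < R \<and> Q lam ?c x = 0"
  proof -
    have "Q lam ?c (e2 + d / 2) < 0" using d(2)[of "d / 2"] d(1) Qe2 by simp
    moreover have "e2 + d / 2 \<le> R" unfolding R_def using sq d(1) by linarith
    ultimately obtain x where "e2 + d / 2 \<le> x" "x \<le> R" "Q lam ?c x = 0"
      using IVT[of "Q lam ?c" "e2 + d / 2" 0 R] R(1) cont by auto
    then show ?thesis using \<open>Q lam ?c (e2 + d / 2) < 0\<close> R(1) by (intro exI[of _ x]) (auto simp: less_le)
  qed
  then obtain e1 where e1: "e1 > e2" "Q lam ?c e1 = 0" using d(1) by force
  define h where "h = min (d' / 2) (e2 / 2)"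
  have h: "0 < h" "h < d'" "e2 - h > 0" unfolding h_def using d'(1) e2 by (auto simp: min_def)
  obtain e3 where e3: "0 \<le> e3" "e3 \<le> e2 - h" "Q lam ?c e3 = 0"
    using IVT[of "Q lam ?c" 0 0 "e2 - h"] Q0 d'(2)[of h] h Qe2 cont by auto
  then have e3': "e3 > 0" "e3 < e2" using Q0 h by (auto simp: less_le)
  have "- R \<le> 0" unfolding R_def using sq e2 d(1) by linarith
  then obtain e4 where e4: "e4 \<le> 0" "Q lam ?c e4 = 0"
    using IVT2[of "Q lam ?c" 0 0 "- R"] Q0 R(2) cont by auto
  then have e4': "e4 < 0" using Q0 by (auto simp: less_le)
  have "card {e1, e2, e3, e4} = 4" using e1 e3' e4' by auto
  then have "{e1, e2, e3, e4} = {x. Q lam ?c x = 0}"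
    using Q_roots_le_4[of lam ?c] e1 e3 e4 Qe2 by (intro card_seteq) auto
  then show ?thesis using that e1 e3' e4' by metis
qed

text \<open>Just below \<open>e2\<close> the quartic is positive, contrary to the first integral; by
  continuity \<open>\<mu>\<close> would have to pass there.\<close>

lemma mu_solution_ge:
  assumes mu: "is_mu_solution lam e2 \<mu>" and mod: "(lam, e2) \<in> moduli_S"
  shows "e2 \<le> \<mu> s"
proof (rule ccontr)
  assume less: "\<not> e2 \<le> \<mu> s"
  let ?c = "c_mod lam e2"
  have e2: "e2 > 0" and k: "e2^4 + 2 * lam * e2^3 + 1 < 0"
    using mod by (auto simp: moduli_S_def moduli_P_def)
  have neg: "2 * (e2^4 + 2 * lam * e2^3 + 1) / e2 < 0" using e2 k by (simp add: divide_neg_pos)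
  obtain d where d: "d > 0" "\<And>h. 0 < h \<Longrightarrow> h < d \<Longrightarrow> Q lam ?c (e2 - h) > Q lam ?c e2"
    using DERIV_neg_dec_left[OF Q_deriv_e2[OF e2] neg] by blast
  have Qe2: "Q lam ?c e2 = 0" using Q_eq_0_iff_c_mod[OF e2] by blast
  have pos: "\<mu> t > 0" and "(\<mu> has_real_derivative dot \<mu> t) (at t)" and "\<mu> 0 = e2" for t
    using mu unfolding is_mu_solution_def by auto
  then have "continuous_on UNIV \<mu>" by (meson DERIV_continuous continuous_at_imp_continuous_on)
  then have "is_interval (range \<mu>)"
    by (simp add: is_interval_connected_1 connected_continuous_image)
  \<comment> \<open>A value between \<open>\<mu> s\<close> and \<open>e2\<close>, below
    \<open>e2\<close> by at most \<open>d / 2\<close>, where \<open>Q\<close> is known to be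
    positive.\<close>
  moreover define y where "y = max (\<mu> s) (e2 - d / 2)"
  ultimately have "y \<in> range \<mu>"
    using mem_is_interval_1_I[of "range \<mu>" "\<mu> s" e2 y] less d(1) \<open>\<mu> 0 = e2\<close> by (auto simp: max_def)
  then obtain t where t: "\<mu> t = y" by auto
  have "Q lam ?c (\<mu> t) > 0"
    using d(2)[of "e2 - y"] less d(1) Qe2 t by (auto simp: y_def)
  then have "(\<mu> t)\<^sup>2 * Q lam ?c (\<mu> t) > 0" using pos[of t] by simp
  then show False
    using mu_solution_first_integral[OF mu e2, of t] zero_le_power2[of "dot \<mu> t"] by linarith
qed

lemma gamma_mod_BS_curve:
  assumes mod: "(lam, e2) \<in> moduli_S" and mu: "is_mu_solution lam e2 \<mu>"
  shows "B_curve_with lam (c_mod lam e2) UNIV (gamma_mod lam (c_mod lam e2) \<mu>)"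
    and "momentum_at lam (gamma_mod lam (c_mod lam e2) \<mu>) s = vector [0, 0, - sqrt (c_mod lam e2)]"
proof -
  define c where "c = c_mod lam e2"
  have e2: "e2 > 0" and k: "e2^4 + 2 * lam * e2^3 + 1 < 0" and c: "c > 0"
    using mod by (auto simp: moduli_S_def moduli_P_def c_def)
  have mu0: "\<mu> 0 = e2" "dot \<mu> 0 = 0" using mu by (auto simp: is_mu_solution_def)
  interpret blaschke_flow lam c \<mu> "dot \<mu>"
    using mu c mu_solution_first_integral[OF mu e2] unfolding c_def
    by unfold_locales (auto simp: is_mu_solution_def)
  define \<Theta> where "\<Theta> = Theta lam c \<mu>"
  have "((\<lambda>s. 2 * sqrt c * (LBINT t=0..s. (\<mu> t)\<^sup>2 * (\<mu> t + 2 * lam) / (1 + 4 * c * (\<mu> t)\<^sup>2)))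
      has_real_derivative 2 * sqrt c * ((\<mu> s)\<^sup>2 * (\<mu> s + 2 * lam) / (1 + 4 * c * (\<mu> s)\<^sup>2))) (at s)" for s :: real
    by (intro DERIV_cmult LBINT_deriv continuous_intros mu_continuous)
      (use one_plus_pos less_irrefl in metis)
  moreover have "2 * sqrt c * ((\<mu> s)\<^sup>2 * (\<mu> s + 2 * lam) / (1 + 4 * c * (\<mu> s)\<^sup>2)) = sqrt c * C s / (\<rho> s)\<^sup>2" for s
    unfolding one_plus_mu C_def using mu_nz[of s] rho_pos[of s] by (simp add: field_simps)
  ultimately have "(\<Theta> has_real_derivative sqrt c * C s / (\<rho> s)\<^sup>2) (at s)" for s
    by (simp add: \<Theta>_def Theta_def[abs_def])
  then interpret blaschke_curve lam c \<mu> "dot \<mu>" \<Theta>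
    by unfold_locales
  have eq: "gamma_mod lam c \<mu> = \<gamma>"
  proof
    show "gamma_mod lam c \<mu> s = \<gamma> s" for s
      unfolding gamma_mod_def \<Theta>_def[symmetric] \<gamma>_def K_def A_def sqrt_mu
      using mu_nz[of s] by (simp add: vec_eq_iff forall_3)
  qed
  \<comment> \<open>Time \<open>0\<close> is a turning point, so \<open>g e2\<close> factors; the
    inequality of \<open>moduli_P\<close> makes both factors negative.\<close>
  have gk: "g e2 = (e2 + 2 * lam) * (1 + 2 * lam * e2^3 + e2^4)" using turning_point(2)[OF mu0(2)] mu0 by simp
  have "e2^3 * (e2 + 2 * lam) < 0" using k by (simp add: algebra_simps eval_nat_numeral)
  then have el: "e2 + 2 * lam < 0" using e2 by (simp add: mult_less_0_iff)
  have "g e2 > 0" unfolding gk using el k by (intro mult_neg_neg) auto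
  moreover have "C 0 < 0" using el by (simp add: C_def mu0)
  ultimately obtain T where T: "T > 0" "\<And>s. \<mu> (s + T) = \<mu> s"
    using periodic_solution[of e2] e2 mu_solution_ge[OF mu mod] mu0(2) by blast
  \<comment> \<open>A constant solution would have zero second derivative at \<open>0\<close>,
    contrary to the strict inequality of \<open>moduli_P\<close>.\<close>
  have "\<exists>s. \<mu> s \<noteq> \<mu> 0"
  proof (rule ccontr)
    assume "\<not> ?thesis"
    then have "\<mu> = (\<lambda>_. \<mu> 0)" by blast
    then have "(\<mu> has_real_derivative 0) (at s)" for s by (metis DERIV_const)
    then have "dot \<mu> = (\<lambda>_. 0)" using mu_deriv DERIV_unique by blast
    then have "(dot \<mu> has_real_derivative 0) (at 0)" by simp
    then have "- \<mu> 0 * (1 + 2 * lam * (\<mu> 0)^3 + (\<mu> 0)^4) = 0"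
      using turning_point(3)[OF mu0(2)] DERIV_unique by blast
    then show False using e2 k mu0 by simp
  qed
  then show "B_curve_with lam (c_mod lam e2) UNIV (gamma_mod lam (c_mod lam e2) \<mu>)"
    unfolding c_def[symmetric] eq using B_curve[OF T] by blast
  show "momentum_at lam (gamma_mod lam (c_mod lam e2) \<mu>) s = vector [0, 0, - sqrt (c_mod lam e2)]"
    unfolding c_def[symmetric] eq by (rule momentum)
qed

theorem theorem3p13:
  shows "(\<forall>lam e2 \<mu>. (lam, e2) \<in> moduli_S \<and> is_mu_solution lam e2 \<mu> \<longrightarrow>
           (let c = c_mod lam e2; \<gamma> = gamma_mod lam c \<mu> in
              BS_curve UNIV \<gamma> \<and> has_modulus UNIV \<gamma> (lam, e2) \<and>
              has_momentum UNIV \<gamma> (vector [0, 0, - sqrt c])))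
       \<and> (\<nexists>I \<gamma>. BS_string I \<gamma>)"
proof (intro conjI allI impI)
  show "\<nexists>I \<gamma>. BS_string I \<gamma>" using no_BS_string by blast
next
  fix lam e2 \<mu>
  assume asm: "(lam, e2) \<in> moduli_S \<and> is_mu_solution lam e2 \<mu>"
  define c where "c = c_mod lam e2"
  define \<gamma> where "\<gamma> = gamma_mod lam c \<mu>"
  define \<xi> :: "real^3" where "\<xi> = vector [0, 0, - sqrt c]"
  have c: "c > 0" using asm by (simp add: moduli_S_def c_def)
  have B: "B_curve_with lam c UNIV \<gamma>" and m: "\<And>s. momentum_at lam \<gamma> s = \<xi>"
    using gamma_mod_BS_curve asm unfolding c_def \<gamma>_def \<xi>_def by blast+
  have mom: "has_momentum UNIV \<gamma> \<xi>" unfolding has_momentum_def using B m by blast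
  have "\<xi> \<bullet>\<^sub>L \<xi> > 0" using c by (simp add: \<xi>_def lorentz_def)
  then have "BS_curve UNIV \<gamma>" unfolding BS_curve_def B_curve_def using B mom by blast
  moreover have "has_modulus UNIV \<gamma> (lam, e2)"
    unfolding has_modulus_def prod.case using B Q_four_roots[of lam e2] asm unfolding c_def by metis
  ultimately show "let c = c_mod lam e2; \<gamma> = gamma_mod lam c \<mu> in
      BS_curve UNIV \<gamma> \<and> has_modulus UNIV \<gamma> (lam, e2) \<and> has_momentum UNIV \<gamma> (vector [0, 0, - sqrt c])"
    using mom unfolding Let_def c_def \<gamma>_def \<xi>_def by blast
qed

end
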